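(* Let $X$ be a bounded geometry metric space with property A. Then the following two conditions are equivalent: (1) $X$ is supramenable; (2) the uniform Roe algebra $C^*_u(X)$ contains no non-zero properly infinite projections.
   Context: A metric space $X$ has bounded geometry if for every $r>0$ there is a uniform (finite) bound on the cardinalities of all $r$-balls in $X$. The uniform Roe algebra $C^*_u(X)$ is the operator norm closure in $\mathcal{B}(\ell^2(X))$ of the $*$-algebra of $X$-by-$X$ complex matrices $(a_{xy})$ with uniformly bounded entries and finite propagation $\sup\{d(x,y)\mid a_{xy}\neq 0\}<\infty$. Property A (for bounded geometry $X$): for all $r,\epsilon>0$ there are $s>0$ and a map $x\mapsto \xi_x$ from $X$ to the non-negative norm one elements of $\ell^1(X)$ such that $\xi_x$ is supported in the $s$-ball around $x$ for each $x$, and $\|\xi_x-\xi_y\|_1<\epsilon$ whenever $d(x,y)\le r$. Equivalently, $C^*_u(X)$ is nuclear. A partial translation on $X$ is a bijection $t:A\to B$ between subsets $A,B\subseteq X$ with $\sup_{x\in A}d(x,t(x))<\infty$. A subspace $A\subseteq X$ is paradoxical if there are a decomposition $A=A_+\sqcup A_-$ and (bijective) partial translations $t_+:A\to A_+$ and $t_-:A\to A_-$. $X$ is supramenable if every non-empty subspace of $X$ is non-paradoxical. A projection $p$ in a $C^*$-algebra $B$ is properly infinite if there exist partial isometries $x,y\in B$ with $x^*x=y^*y=p$ and $xx^*+yy^*\le p$. *)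

theory Defs
  imports "HOL-Analysis.Analysis"
begin

section \<open>The Hilbert space of square-summable functions\<close>

typedef 'a ell2 = "{f :: 'a \<Rightarrow> complex. (\<lambda>x. (cmod (f x))\<^sup>2) summable_on UNIV}"
  morphisms coord Abs_ell2
  by (intro exI[of _ "\<lambda>_. 0"]) simp

lemma coord_summable: "(\<lambda>x. (cmod (coord f x))\<^sup>2) summable_on UNIV"
  using coord[of f] by simp

lemma ell2_eqI: "(\<And>x. coord f x = coord g x) \<Longrightarrow> f = g"
  by (metis coord_inject ext)

lemma ell2_closed_add:
  assumes "(\<lambda>x. (cmod (f x))\<^sup>2) summable_on UNIV" and "(\<lambda>x. (cmod (g x))\<^sup>2) summable_on UNIV"
  shows "(\<lambda>x. (cmod (f x + g x))\<^sup>2) summable_on UNIV"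
proof (rule summable_on_comparison_test)
  show "(\<lambda>x. 2 * (cmod (f x))\<^sup>2 + 2 * (cmod (g x))\<^sup>2) summable_on UNIV"
    by (intro summable_on_add summable_on_cmult_right assms)
  fix x
  have "(cmod (f x + g x))\<^sup>2 \<le> (cmod (f x) + cmod (g x))\<^sup>2"
    by (intro power_mono norm_triangle_ineq) simp
  also have "\<dots> \<le> 2 * (cmod (f x))\<^sup>2 + 2 * (cmod (g x))\<^sup>2"
    using zero_le_power2[of "cmod (f x) - cmod (g x)"] by (simp add: power2_sum power2_diff)
  finally show "(cmod (f x + g x))\<^sup>2 \<le> 2 * (cmod (f x))\<^sup>2 + 2 * (cmod (g x))\<^sup>2" .
qed simp

lemma ell2_closed_scale:
  assumes "(\<lambda>x. (cmod (f x))\<^sup>2) summable_on UNIV"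
  shows "(\<lambda>x. (cmod (c * f x))\<^sup>2) summable_on UNIV"
  unfolding norm_mult power_mult_distrib by (intro summable_on_cmult_right assms)

instantiation ell2 :: (type) real_normed_vector
begin

definition zero_ell2 :: "'a ell2" where
  "0 = Abs_ell2 (\<lambda>_. 0)"

definition plus_ell2 :: "'a ell2 \<Rightarrow> 'a ell2 \<Rightarrow> 'a ell2" where
  "f + g = Abs_ell2 (\<lambda>x. coord f x + coord g x)"

definition scaleR_ell2 :: "real \<Rightarrow> 'a ell2 \<Rightarrow> 'a ell2" where
  "r *\<^sub>R f = Abs_ell2 (\<lambda>x. complex_of_real r * coord f x)"

definition uminus_ell2 :: "'a ell2 \<Rightarrow> 'a ell2" where
  "- f = (-1) *\<^sub>R f" for f :: "'a ell2"

definition minus_ell2 :: "'a ell2 \<Rightarrow> 'a ell2 \<Rightarrow> 'a ell2" where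
  "f - g = f + (- g)" for f g :: "'a ell2"

definition norm_ell2 :: "'a ell2 \<Rightarrow> real" where
  "norm f = sqrt (\<Sum>\<^sub>\<infinity>x. (cmod (coord f x))\<^sup>2)"

definition dist_ell2 :: "'a ell2 \<Rightarrow> 'a ell2 \<Rightarrow> real" where
  "dist f g = norm (f - g)" for f g :: "'a ell2"

definition sgn_ell2 :: "'a ell2 \<Rightarrow> 'a ell2" where
  "sgn f = inverse (norm f) *\<^sub>R f" for f :: "'a ell2"

definition uniformity_ell2 :: "('a ell2 \<times> 'a ell2) filter" where
  "uniformity_ell2 = (INF e\<in>{0<..}. principal {(f, g). dist f g < e})"

definition open_ell2 :: "'a ell2 set \<Rightarrow> bool" where
  "open_ell2 U \<longleftrightarrow> (\<forall>f\<in>U. eventually (\<lambda>(f', g). f' = f \<longrightarrow> g \<in> U) uniformity)"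

lemma coord_zero [simp]: "coord 0 x = 0"
  by (simp add: zero_ell2_def Abs_ell2_inverse)

lemma coord_plus [simp]: "coord (f + g) x = coord f x + coord g x"
  by (simp add: plus_ell2_def Abs_ell2_inverse ell2_closed_add coord_summable)

lemma coord_scaleR [simp]: "coord (r *\<^sub>R f) x = complex_of_real r * coord f x"
  unfolding scaleR_ell2_def
  by (subst Abs_ell2_inverse) (use ell2_closed_scale[OF coord_summable] in auto)

lemma coord_uminus [simp]: "coord (- f) x = - coord f x"
  by (simp add: uminus_ell2_def)

lemma coord_minus [simp]: "coord (f - g) x = coord f x - coord g x"
  by (simp add: minus_ell2_def)

lemma L2_set_le_norm_ell2:
  assumes "finite F"
  shows "L2_set (\<lambda>x. cmod (coord f x)) F \<le> norm f"
  unfolding L2_set_def norm_ell2_def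
  by (intro real_sqrt_le_mono finite_sum_le_infsum coord_summable assms) auto

lemma norm_ell2_leI:
  assumes "0 \<le> C" and "\<And>F. finite F \<Longrightarrow> L2_set (\<lambda>x. cmod (coord f x)) F \<le> C"
  shows "norm f \<le> C"
proof -
  have "(\<Sum>\<^sub>\<infinity>x. (cmod (coord f x))\<^sup>2) \<le> C\<^sup>2"
  proof (rule infsum_le_finite_sums[OF coord_summable])
    fix F :: "'a set" assume "finite F"
    then show "(\<Sum>x\<in>F. (cmod (coord f x))\<^sup>2) \<le> C\<^sup>2"
      using assms(2)[of F] by (auto simp: L2_set_def dest: sqrt_le_D)
  qed
  then show ?thesis
    unfolding norm_ell2_def using assms(1) by (simp add: real_le_lsqrt infsum_nonneg)
qed

instance
proof
  fix f g h :: "'a ell2" and r s :: real and U :: "'a ell2 set"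
  show "f + g + h = f + (g + h)" "f + g = g + f" "0 + f = f" "- f + f = 0" "f - g = f + - g"
    "r *\<^sub>R (f + g) = r *\<^sub>R f + r *\<^sub>R g" "(r + s) *\<^sub>R f = r *\<^sub>R f + s *\<^sub>R f"
    "r *\<^sub>R s *\<^sub>R f = (r * s) *\<^sub>R f" "1 *\<^sub>R f = f"
    by (auto intro!: ell2_eqI simp: algebra_simps)
  show "dist f g = norm (f - g)" "sgn f = inverse (norm f) *\<^sub>R f"
    by (fact dist_ell2_def sgn_ell2_def)+
  show "(uniformity :: ('a ell2 \<times> 'a ell2) filter) =
      (INF e\<in>{0<..}. principal {(x, y). dist x y < e})"
    by (fact uniformity_ell2_def)
  show "open U = (\<forall>x\<in>U. \<forall>\<^sub>F (x', y) in uniformity. x' = x \<longrightarrow> y \<in> U)"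
    by (fact open_ell2_def)
  show "norm f = 0 \<longleftrightarrow> f = 0"
  proof
    assume "norm f = 0"
    then have "(\<Sum>\<^sub>\<infinity>x. (cmod (coord f x))\<^sup>2) = 0"
      by (simp add: norm_ell2_def)
    then have "(cmod (coord f x))\<^sup>2 = 0" for x
      using nonneg_infsum_le_0D[OF _ coord_summable, of f x] by simp
    then show "f = 0"
      by (intro ell2_eqI) simp
  qed (simp add: norm_ell2_def)
  have nonneg: "0 \<le> norm k" for k :: "'a ell2"
    by (simp add: norm_ell2_def infsum_nonneg)
  show "norm (f + g) \<le> norm f + norm g"
  proof (rule norm_ell2_leI)
    fix F :: "'a set" assume F: "finite F"
    have "L2_set (\<lambda>x. cmod (coord (f + g) x)) F
        \<le> L2_set (\<lambda>x. cmod (coord f x) + cmod (coord g x)) F"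
      by (intro L2_set_mono) (auto intro: norm_triangle_ineq)
    also have "\<dots> \<le> L2_set (\<lambda>x. cmod (coord f x)) F + L2_set (\<lambda>x. cmod (coord g x)) F"
      by (rule L2_set_triangle_ineq)
    also have "\<dots> \<le> norm f + norm g"
      by (intro add_mono L2_set_le_norm_ell2 F)
    finally show "L2_set (\<lambda>x. cmod (coord (f + g) x)) F \<le> norm f + norm g" .
  qed (simp add: nonneg)
  show "norm (r *\<^sub>R f) = \<bar>r\<bar> * norm f"
    by (simp add: norm_ell2_def norm_mult power_mult_distrib infsum_cmult_right' real_sqrt_mult)
qed

end

definition cinner :: "'a ell2 \<Rightarrow> 'a ell2 \<Rightarrow> complex" where
  "cinner f g = (\<Sum>\<^sub>\<infinity>x. cnj (coord f x) * coord g x)"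


section \<open>Operators\<close>

text \<open>
  The type \<open>'a ell2 \<Rightarrow>\<^sub>L 'a ell2\<close> consists of the bounded real-linear operators. The complex-linear ones
  form a norm-closed subspace of it with the same operator norm, and all operators occurring below
  lie in that subspace.
\<close>

type_synonym 'a op2 = "'a ell2 \<Rightarrow>\<^sub>L 'a ell2"

text \<open>
  The adjoint is unique when it exists, and it exists for every complex-linear operator by the Riesz
  representation theorem; its value on other real-linear operators is irrelevant.
\<close>

definition adj :: "'a op2 \<Rightarrow> 'a op2" where
  "adj T = (THE S :: 'a op2. \<forall>f g. cinner (S f) g = cinner f (T g))"

definition positive_op :: "'a op2 \<Rightarrow> bool" where
  "positive_op T \<longleftrightarrow> (\<forall>f. cinner f (T f) \<in> \<real> \<and> 0 \<le> Re (cinner f (T f)))"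

definition op_le :: "'a op2 \<Rightarrow> 'a op2 \<Rightarrow> bool" where
  "op_le S T \<longleftrightarrow> positive_op (T - S)"

definition projection :: "'a op2 \<Rightarrow> bool" where
  "projection p \<longleftrightarrow> p o\<^sub>L p = p \<and> adj p = p"

definition partial_isometry :: "'a op2 \<Rightarrow> bool" where
  "partial_isometry v \<longleftrightarrow> v o\<^sub>L adj v o\<^sub>L v = v"

definition properly_infinite_projection :: "'a op2 set \<Rightarrow> 'a op2 \<Rightarrow> bool" where
  "properly_infinite_projection B p \<longleftrightarrow> p \<in> B \<and> projection p \<and>
    (\<exists>x\<in>B. \<exists>y\<in>B. partial_isometry x \<and> partial_isometry y \<and>
      (adj x o\<^sub>L x) = p \<and> (adj y o\<^sub>L y) = p \<and> op_le ((x o\<^sub>L adj x) + (y o\<^sub>L adj y)) p)"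


section \<open>Coarse geometry\<close>

definition bounded_geometry :: "'a::metric_space itself \<Rightarrow> bool" where
  "bounded_geometry _ \<longleftrightarrow>
    (\<forall>r>0. \<exists>N. \<forall>x::'a. finite (cball x r) \<and> card (cball x r) \<le> N)"

definition property_A :: "'a::metric_space itself \<Rightarrow> bool" where
  "property_A _ \<longleftrightarrow>
    (\<forall>r>0. \<forall>\<epsilon>>0. \<exists>s>0. \<exists>\<xi> :: 'a \<Rightarrow> 'a \<Rightarrow> real.
      (\<forall>x. (\<forall>z. 0 \<le> \<xi> x z) \<and> (\<xi> x has_sum 1) UNIV \<and> (\<forall>z. \<xi> x z \<noteq> 0 \<longrightarrow> z \<in> cball x s)) \<and>
      (\<forall>x y. dist x y \<le> r \<longrightarrow> (\<Sum>\<^sub>\<infinity>z. \<bar>\<xi> x z - \<xi> y z\<bar>) < \<epsilon>))"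

definition partial_translation ::
    "('a::metric_space \<Rightarrow> 'a) \<Rightarrow> 'a set \<Rightarrow> 'a set \<Rightarrow> bool" where
  "partial_translation t A B \<longleftrightarrow> bij_betw t A B \<and> bdd_above ((\<lambda>x. dist x (t x)) ` A)"

definition paradoxical :: "'a::metric_space set \<Rightarrow> bool" where
  "paradoxical A \<longleftrightarrow> (\<exists>A1 A2 t1 t2. A = A1 \<union> A2 \<and> A1 \<inter> A2 = {} \<and>
    partial_translation t1 A A1 \<and> partial_translation t2 A A2)"

definition supramenable :: "'a::metric_space itself \<Rightarrow> bool" where
  "supramenable _ \<longleftrightarrow> (\<forall>A :: 'a set. A \<noteq> {} \<longrightarrow> \<not> paradoxical A)"


section \<open>The uniform Roe algebra\<close>

definition bounded_entries :: "('a \<Rightarrow> 'a \<Rightarrow> complex) \<Rightarrow> bool" where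
  "bounded_entries a \<longleftrightarrow> (\<exists>C. \<forall>x y. cmod (a x y) \<le> C)"

definition finite_propagation :: "('a::metric_space \<Rightarrow> 'a \<Rightarrow> complex) \<Rightarrow> bool" where
  "finite_propagation a \<longleftrightarrow> bdd_above {dist x y | x y. a x y \<noteq> 0}"

text \<open>
  Under bounded geometry every row of a finite propagation matrix has finite support, so that the
  sums below are finite, and every such matrix with bounded entries acts as a bounded operator.
\<close>

definition algebraic_roe_algebra :: "'a::metric_space op2 set" where
  "algebraic_roe_algebra = {T :: 'a op2. \<exists>a. bounded_entries a \<and> finite_propagation a \<and>
    (\<forall>f x. coord (T f) x = (\<Sum>\<^sub>\<infinity>y. a x y * coord f y))}"

definition uniform_roe_algebra :: "'a::metric_space op2 set" where
  "uniform_roe_algebra = closure algebraic_roe_algebra"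

end

(*
  If A is paradoxical, its two partial translations act as isometries showing that the projection
  onto l^2(A) is properly infinite. Conversely let p be a non-zero properly infinite projection.
  Property A provides finite propagation Schur multipliers, which show that p is concentrated on the
  set A of points x with |p e_x| >= delta, up to norm 1/2. If A were not paradoxical, Hall's theorem
  would give Foelner sets in A, and averaging diagonal entries over them is asymptotically tracial on
  the corner of 1_A. By the norm estimate p 1_A p is invertible in the corner of p, with inverse h
  given by a Neumann series, and z |-> tau(z h) is then asymptotically tracial on the corner of p.
  It takes the same value on the k orthogonal subprojections of p obtained from proper infiniteness,
  so that k tau(h) stays bounded although tau(h) >= delta^2.
*)

theory Submission
  imports Defs
begin

subsection \<open>Operators on the Hilbert space\<close>

text \<open>The obstacle is that \<open>p\<close> is only close to the corner of \<open>1_A\<close>,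
  whereas Foelner averages are tracial only for products with \<open>1_A\<close> in the middle. Put
  \<open>q = p 1_(-A) p\<close>, of norm at most 1/2. Then \<open>p 1_A p\<close> is the unit
  \<open>p\<close> of the corner minus \<open>q\<close>, and
  \<open>h = p + q + ... + q^(N-1)\<close> satisfies \<open>h 1_A p = p - q^N\<close>. Inserting
  this between \<open>u\<close> and \<open>v\<close> rewrites \<open>u v h\<close> as
  \<open>(u h) 1_A (v h)\<close> up to an error of order \<open>2^(-N)\<close>. Positivity of the
  powers of \<open>q\<close> makes the diagonal of \<open>h\<close> dominate that of
  \<open>p\<close>, which is at least \<open>\<delta>^2\<close> on \<open>A\<close>. Cutting out
  \<open>A\<close> by column norms thus keeps the averages of \<open>h\<close> away from 0, while
  averages over Foelner sets of the whole space may vanish on \<open>p\<close>. Property A excludes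
  projections of infinite rank whose columns become small off finite sets: for those no threshold
  would do. No limit functional is formed. All estimates hold for large indices of a Foelner
  sequence, and the errors of the \<open>k\<close> comparisons are budgeted against
  \<open>k * \<delta>^2\<close>.\<close>

lemma norm_ell2_sq: "(norm f)\<^sup>2 = (\<Sum>\<^sub>\<infinity>x. (cmod (coord f x))\<^sup>2)"
  unfolding norm_ell2_def by (simp add: infsum_nonneg)

lemma cinner_abs_summable: "(\<lambda>x. norm (cnj (coord f x) * coord g x)) summable_on UNIV"
proof (rule summable_on_comparison_test)
  show "(\<lambda>x. (cmod (coord f x))\<^sup>2 + (cmod (coord g x))\<^sup>2) summable_on UNIV"
    by (intro summable_on_add coord_summable)
  fix x
  have "2 * (cmod (coord f x) * cmod (coord g x)) \<le> (cmod (coord f x))\<^sup>2 + (cmod (coord g x))\<^sup>2"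
    using sum_squares_bound[of "cmod (coord f x)" "cmod (coord g x)"] by (simp add: mult.assoc)
  moreover have "0 \<le> cmod (coord f x) * cmod (coord g x)"
    by simp
  ultimately show "norm (cnj (coord f x) * coord g x) \<le> (cmod (coord f x))\<^sup>2 + (cmod (coord g x))\<^sup>2"
    unfolding norm_mult complex_mod_cnj by linarith
qed auto

lemma cinner_summable: "(\<lambda>x. cnj (coord f x) * coord g x) summable_on UNIV"
  by (rule abs_summable_summable[OF cinner_abs_summable])

lemma cinner_commute: "cinner g f = cnj (cinner f g)"
proof -
  have "cnj (cinner f g) = (\<Sum>\<^sub>\<infinity>x. cnj (cnj (coord f x) * coord g x))"
    unfolding cinner_def by (rule infsum_cnj[symmetric])
  then show ?thesis
    unfolding cinner_def by (simp add: mult.commute)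
qed

lemma cinner_add_right: "cinner f (g + h) = cinner f g + cinner f h"
  unfolding cinner_def coord_plus distrib_left
  by (rule infsum_add[OF cinner_summable cinner_summable])

lemma cinner_minus_right: "cinner f (- g) = - cinner f g"
  unfolding cinner_def by (simp add: infsum_uminus)

lemma cinner_diff_right: "cinner f (g - h) = cinner f g - cinner f h"
  by (metis cinner_add_right cinner_minus_right add_uminus_conv_diff)

lemma cinner_add_left: "cinner (g + h) f = cinner g f + cinner h f"
  by (metis cinner_add_right cinner_commute complex_cnj_add)

lemma cinner_diff_left: "cinner (g - h) f = cinner g f - cinner h f"
  by (metis cinner_diff_right cinner_commute complex_cnj_diff)

lemma cinner_zero_right [simp]: "cinner f 0 = 0"
  by (simp add: cinner_def)

lemma cinner_zero_left [simp]: "cinner 0 f = 0"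
  by (simp add: cinner_def)

lemma cinner_self: "cinner f f = of_real ((norm f)\<^sup>2)"
proof -
  have "cinner f f = (\<Sum>\<^sub>\<infinity>x. of_real ((cmod (coord f x))\<^sup>2))"
    unfolding cinner_def complex_norm_square by (simp add: mult.commute)
  also have "\<dots> = of_real (\<Sum>\<^sub>\<infinity>x. (cmod (coord f x))\<^sup>2)"
    by (rule infsumI[OF has_sum_of_real_iff[THEN iffD2, OF has_sum_infsum[OF coord_summable]]])
  finally show ?thesis
    by (simp add: norm_ell2_sq)
qed

lemma cinner_cauchy_schwarz: "cmod (cinner f g) \<le> norm f * norm g"
proof -
  have "(\<Sum>\<^sub>\<infinity>x. cmod (cnj (coord f x) * coord g x)) \<le> norm f * norm g"
  proof (rule infsum_le_finite_sums[OF cinner_abs_summable])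
    fix F :: "'a set" assume F: "finite F"
    have "(\<Sum>x\<in>F. cmod (cnj (coord f x) * coord g x)) =
        (\<Sum>x\<in>F. \<bar>cmod (coord f x)\<bar> * \<bar>cmod (coord g x)\<bar>)"
      by (simp add: norm_mult)
    also have "\<dots> \<le> L2_set (\<lambda>x. cmod (coord f x)) F * L2_set (\<lambda>x. cmod (coord g x)) F"
      by (rule L2_set_mult_ineq)
    also have "\<dots> \<le> norm f * norm g"
      by (intro mult_mono L2_set_le_norm_ell2 F) (auto simp: L2_set_nonneg)
    finally show "(\<Sum>x\<in>F. cmod (cnj (coord f x) * coord g x)) \<le> norm f * norm g" .
  qed
  then show ?thesis
    unfolding cinner_def using norm_infsum_bound[OF cinner_abs_summable[of f g]] by linarith
qed

lemma cmod_coord_le: "cmod (coord f x) \<le> norm f"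
  using L2_set_le_norm_ell2[of "{x}" f] by simp

lemma coord_sum [simp]: "coord (\<Sum>i\<in>I. f i) x = (\<Sum>i\<in>I. coord (f i) x)"
  by (induction I rule: infinite_finite_induct) auto

lemma cinner_sum_right: "cinner f (\<Sum>i\<in>I. g i) = (\<Sum>i\<in>I. cinner f (g i))"
  by (induction I rule: infinite_finite_induct) (auto simp: cinner_add_right)

section \<open>Diagonal operators and the standard basis\<close>

definition diag :: "('a \<Rightarrow> complex) \<Rightarrow> 'a op2" where
  "diag d = Blinfun (\<lambda>f. Abs_ell2 (\<lambda>x. d x * coord f x))"

text \<open>\<open>Blinfun\<close> is unspecified off the bounded linear maps, so facts about
  \<open>diag d\<close> presuppose the bound \<open>C\<close>.\<close>

lemma
  assumes d: "\<And>x. cmod (d x) \<le> C"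
  shows coord_diag: "coord (diag d f) x = d x * coord f x"
    and norm_diag_le: "norm (diag d) \<le> C"
proof -
  have C: "0 \<le> C"
    using d norm_ge_zero order_trans by blast
  define D where "D f = Abs_ell2 (\<lambda>x. d x * coord f x)" for f
  have sm: "(\<lambda>x. (cmod (d x * coord f x))\<^sup>2) summable_on UNIV" for f
  proof (rule summable_on_comparison_test)
    show "(\<lambda>x. C\<^sup>2 * (cmod (coord f x))\<^sup>2) summable_on UNIV"
      by (intro summable_on_cmult_right coord_summable)
    show "(cmod (d x * coord f x))\<^sup>2 \<le> C\<^sup>2 * (cmod (coord f x))\<^sup>2" for x
      unfolding norm_mult power_mult_distrib by (intro mult_right_mono power_mono d) auto
  qed auto
  have cD: "coord (D f) x = d x * coord f x" for f x
    unfolding D_def using sm by (simp add: Abs_ell2_inverse)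
  have nD: "norm (D f) \<le> norm f * C" for f
  proof (rule norm_ell2_leI)
    fix F :: "'a set" assume F: "finite F"
    have "L2_set (\<lambda>x. cmod (coord (D f) x)) F \<le> L2_set (\<lambda>x. C * cmod (coord f x)) F"
      unfolding cD norm_mult by (intro L2_set_mono mult_right_mono d) auto
    also have "\<dots> = C * L2_set (\<lambda>x. cmod (coord f x)) F"
      using C by (simp add: L2_set_right_distrib)
    also have "\<dots> \<le> norm f * C"
      using L2_set_le_norm_ell2[OF F, of f] C by (simp add: mult.commute mult_left_mono)
    finally show "L2_set (\<lambda>x. cmod (coord (D f) x)) F \<le> norm f * C" .
  qed (use C in auto)
  have "bounded_linear D"
  proof (rule bounded_linear_intro)
    show "D (f + g) = D f + D g" "D (r *\<^sub>R f) = r *\<^sub>R D f" for f g r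
      by (auto intro!: ell2_eqI simp: cD algebra_simps)
  qed (rule nD)
  then have ap: "blinfun_apply (diag d) = D"
    unfolding diag_def D_def by (rule bounded_linear_Blinfun_apply)
  show "coord (diag d f) x = d x * coord f x"
    by (simp add: ap cD)
  show "norm (diag d) \<le> C"
    using nD C by (intro norm_blinfun_bound) (auto simp: ap mult.commute)
qed

definition ind :: "'a set \<Rightarrow> 'a op2" where
  "ind A = diag (\<lambda>x. if x \<in> A then 1 else 0)"

lemma coord_ind [simp]: "coord (ind A f) x = (if x \<in> A then coord f x else 0)"
  unfolding ind_def by (subst coord_diag[where C = 1]) auto

lemma ind_UNIV [simp]: "ind UNIV f = f"
  by (rule ell2_eqI) simp

lemma norm_ind_le: "norm (ind A) \<le> 1"
  unfolding ind_def by (rule norm_diag_le) auto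

text \<open>The type class supplies only real scalars. Complex multiplication as a constant diagonal
  operator is continuous by construction, which \<open>closed_clin\<close> exploits.\<close>

definition scale :: "complex \<Rightarrow> 'a ell2 \<Rightarrow> 'a ell2" where
  "scale c = blinfun_apply (diag (\<lambda>_. c))"

lemma coord_scale [simp]: "coord (scale c f) x = c * coord f x"
  unfolding scale_def by (subst coord_diag[where C = "cmod c"]) auto

lemma cinner_scale_right: "cinner f (scale c g) = c * cinner f g"
  unfolding cinner_def by (simp add: infsum_cmult_right'[symmetric] mult.left_commute)

lemma cinner_scale_left: "cinner (scale c f) g = cnj c * cinner f g"
  by (metis cinner_commute cinner_scale_right complex_cnj_mult)

lemma scale_add: "scale c (f + g) = scale c f + scale c g"
  by (rule ell2_eqI) (simp add: algebra_simps)

lemma scale_diff: "scale c (f - g) = scale c f - scale c g"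
  by (rule ell2_eqI) (simp add: algebra_simps)

definition ket :: "'a \<Rightarrow> 'a ell2" where
  "ket y = Abs_ell2 (\<lambda>x. if x = y then 1 else 0)"

lemma coord_ket [simp]: "coord (ket y) x = (if x = y then 1 else 0)"
proof -
  have "(\<lambda>x. (cmod (if x = y then 1 else 0))\<^sup>2) summable_on {y}"
    by simp
  then have "(\<lambda>x. (cmod (if x = y then 1 else 0))\<^sup>2) summable_on UNIV"
    by (rule summable_on_cong_neutral[THEN iffD1, rotated -1]) auto
  then show ?thesis
    unfolding ket_def by (simp add: Abs_ell2_inverse)
qed

lemma cinner_ket_left [simp]: "cinner (ket x) f = coord f x"
proof -
  have "cinner (ket x) f = (\<Sum>\<^sub>\<infinity>y\<in>{x}. coord f y)"
    unfolding cinner_def by (rule infsum_cong_neutral) (auto split: if_splits)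
  then show ?thesis by simp
qed

lemma norm_ket [simp]: "norm (ket x) = 1"
proof -
  have "complex_of_real ((norm (ket x))\<^sup>2) = 1"
    unfolding cinner_self[symmetric] by simp
  then have "(norm (ket x))\<^sup>2 = 1\<^sup>2"
    by (metis of_real_eq_1_iff one_power2)
  then show ?thesis
    by (rule power2_eq_imp_eq) auto
qed

lemma ind_eq_sum_ket:
  assumes "finite F" shows "ind F f = (\<Sum>y\<in>F. scale (coord f y) (ket y))"
  using assms by (intro ell2_eqI) (auto simp: if_distrib if_distribR sum.delta' cong: if_cong)

lemma norm_ind_finite:
  assumes F: "finite F" shows "norm (ind F f) = L2_set (\<lambda>x. cmod (coord f x)) F"
proof -
  have "(norm (ind F f))\<^sup>2 = (\<Sum>\<^sub>\<infinity>x\<in>F. (cmod (coord f x))\<^sup>2)"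
    unfolding norm_ell2_sq by (rule infsum_cong_neutral) (auto split: if_splits)
  then have "norm (ind F f) = sqrt (\<Sum>x\<in>F. (cmod (coord f x))\<^sup>2)"
    using F by (simp add: real_sqrt_unique)
  then show ?thesis
    by (simp add: L2_set_def)
qed

lemma coord_sum_ket:
  assumes "finite F"
  shows "coord (\<Sum>x\<in>F. scale (c x) (ket x)) x = (if x \<in> F then c x else 0)"
  using assms by (simp add: if_distrib sum.delta' cong: if_cong)

lemma norm_sum_ket:
  assumes F: "finite F"
  shows "norm (\<Sum>x\<in>F. scale (c x) (ket x)) = L2_set (\<lambda>x. cmod (c x)) F"
proof -
  let ?g = "\<Sum>x\<in>F. scale (c x) (ket x)"
  have "?g = ind F ?g"
    by (rule ell2_eqI) (simp only: coord_ind coord_sum_ket[OF F] if_cancel split: if_splits, simp)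
  then have "norm ?g = L2_set (\<lambda>x. cmod (coord ?g x)) F"
    using norm_ind_finite[OF F, of ?g] by simp
  also have "\<dots> = L2_set (\<lambda>x. cmod (c x)) F"
    by (rule L2_set_cong) (simp_all only: coord_sum_ket[OF F] if_True)
  finally show ?thesis .
qed

text \<open>Pythagoras: \<open>f - ind F f\<close> is orthogonal to \<open>ind F f\<close>, so its
  squared norm is the gap between \<open>(norm f)^2\<close> and the partial sum over
  \<open>F\<close>.\<close>

lemma ind_finite_dense:
  assumes "0 < e" obtains F where "finite F" "norm (f - ind F f) < e"
proof -
  have "((\<lambda>x. (cmod (coord f x))\<^sup>2) has_sum (norm f)\<^sup>2) UNIV"
    by (metis norm_ell2_sq coord_summable has_sum_infsum)
  then have "((\<lambda>F. \<Sum>x\<in>F. (cmod (coord f x))\<^sup>2) \<longlongrightarrow> (norm f)\<^sup>2) (finite_subsets_at_top UNIV)"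
    by (simp add: has_sum_def)
  then have "\<forall>\<^sub>F F in finite_subsets_at_top UNIV. 
      dist (\<Sum>x\<in>F. (cmod (coord f x))\<^sup>2) ((norm f)\<^sup>2) < e\<^sup>2"
    using assms by (intro tendstoD) auto
  then obtain F where F: "finite F" "dist (\<Sum>x\<in>F. (cmod (coord f x))\<^sup>2) ((norm f)\<^sup>2) < e\<^sup>2"
    unfolding eventually_finite_subsets_at_top by blast
  have orth: "cinner (ind F f) (f - ind F f) = 0"
    unfolding cinner_def by (rule infsum_0) auto
  have "cinner f f = cinner (ind F f + (f - ind F f)) (ind F f + (f - ind F f))"
    by simp
  also have "\<dots> = cinner (ind F f) (ind F f) + cinner (f - ind F f) (f - ind F f)"
    using orth cinner_commute[of "f - ind F f" "ind F f"] 
    by (simp only: cinner_add_left cinner_add_right) simp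
  finally have "(norm f)\<^sup>2 = (norm (ind F f))\<^sup>2 + (norm (f - ind F f))\<^sup>2"
    unfolding cinner_self by (metis of_real_add of_real_eq_iff)
  moreover have "(norm (ind F f))\<^sup>2 = (\<Sum>x\<in>F. (cmod (coord f x))\<^sup>2)"
    by (simp add: norm_ind_finite F L2_set_def sum_nonneg)
  ultimately have "(norm (f - ind F f))\<^sup>2 < e\<^sup>2"
    using F(2) by (simp add: dist_real_def)
  then have "norm (f - ind F f) < e"
    using assms by (simp add: power_less_imp_less_base)
  with F show ?thesis using that by blast
qed

lemma ind_ket: "ind A (ket y) = (if y \<in> A then ket y else 0)"
  by (rule ell2_eqI) auto

text \<open>Additivity and real homogeneity are built into \<open>'a op2\<close>; commuting with
  complex scalars is the missing part of complex linearity.\<close>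

definition clin :: "'a op2 \<Rightarrow> bool" where
  "clin T \<longleftrightarrow> (\<forall>c f. T (scale c f) = scale c (T f))"

lemma clin_ind [simp]: "clin (ind A)"
  unfolding clin_def by (auto intro!: ell2_eqI)

lemma clin_add [simp]: "clin S \<Longrightarrow> clin T \<Longrightarrow> clin (S + T)"
  by (simp add: clin_def blinfun.add_left scale_add)

lemma clin_diff [simp]: "clin S \<Longrightarrow> clin T \<Longrightarrow> clin (S - T)"
  by (simp add: clin_def blinfun.diff_left scale_diff)

lemma clin_compose [simp]: "clin S \<Longrightarrow> clin T \<Longrightarrow> clin (S o\<^sub>L T)"
  by (simp add: clin_def)

lemma ell2_cinner_eqI: "(\<And>g. cinner f g = cinner h g) \<Longrightarrow> f = h"
  by (metis cinner_commute cinner_ket_left ell2_eqI)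

lemma adj_unique:
  fixes S T :: "'a op2"
  assumes "\<And>f g. cinner (S f) g = cinner f (T g)" shows "adj T = S"
  unfolding adj_def
proof (rule the_equality)
  fix S' :: "'a op2" assume S': "\<forall>f g. cinner (S' f) g = cinner f (T g)"
  show "S' = S"
    by (intro blinfun_eqI ell2_cinner_eqI) (simp add: S' assms)
qed (simp add: assms)

lemma clin_sum_ket:
  assumes "clin T" "finite F"
  shows "T (ind F f) = (\<Sum>y\<in>F. scale (coord f y) (T (ket y)))"
  using assms by (simp add: ind_eq_sum_ket blinfun.sum_right clin_def)

text \<open>An intersection of equalisers of continuous maps. It passes complex linearity on to the
  norm limits in the uniform Roe algebra.\<close>

lemma closed_clin: "closed {T :: 'a op2. clin T}"
proof -
  have "{T :: 'a op2. clin T} = (\<Inter>c. \<Inter>f. {T :: 'a op2. T (scale c f) = scale c (T f)})"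
    by (auto simp: clin_def)
  also have "closed \<dots>"
    unfolding scale_def
    by (intro closed_INT ballI closed_Collect_eq continuous_intros) 
  finally show ?thesis .
qed

text \<open>The adjoint is built from its coordinates \<open>\<langle>T e\<^sub>x, f\<rangle>\<close>, which avoids the Riesz theorem and the
  completeness of \<open>\<ell>\<^sup>2\<close>.\<close>

lemma
  fixes T :: "'a op2"
  assumes T: "clin T"
  shows cinner_adj_left: "cinner (adj T f) g = cinner f (T g)"
    and norm_adj_le: "norm (adj T) \<le> norm T"
proof -
  define s where "s f x = cinner (T (ket x)) f" for f x
  have bound: "L2_set (\<lambda>x. cmod (s f x)) F \<le> norm T * norm f" if F: "finite F" for f F
  proof -
    let ?n = "L2_set (\<lambda>x. cmod (s f x)) F"
    \<comment> \<open>Pairing with this truncation of the prospective adjoint vector returns exactly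
      \<open>?n^2\<close>; one factor \<open>?n\<close> then cancels.\<close>
    define g where "g = (\<Sum>x\<in>F. scale (s f x) (ket x))"
    have ng: "norm g = ?n"
      unfolding g_def by (rule norm_sum_ket[OF F])
    have "cinner f (T g) = (\<Sum>x\<in>F. s f x * cinner f (T (ket x)))"
      using T by (simp add: g_def blinfun.sum_right clin_def cinner_sum_right cinner_scale_right)
    also have "\<dots> = (\<Sum>x\<in>F. of_real ((cmod (s f x))\<^sup>2))"
      by (simp only: complex_norm_square s_def cinner_commute[of f])
    also have "\<dots> = of_real (?n\<^sup>2)"
      by (simp add: L2_set_def sum_nonneg)
    finally have "?n\<^sup>2 = cmod (cinner f (T g))"
      by (simp only: norm_of_real abs_power2)
    also have "\<dots> \<le> norm f * norm (T g)"
      by (rule cinner_cauchy_schwarz)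
    also have "\<dots> \<le> norm f * (norm T * ?n)"
      unfolding ng[symmetric] by (intro mult_left_mono norm_blinfun) auto
    finally have "?n * ?n \<le> (norm T * norm f) * ?n"
      by (simp add: power2_eq_square algebra_simps)
    then show ?thesis
      using L2_set_nonneg[of "\<lambda>x. cmod (s f x)" F]
      by (metis mult_le_cancel_right norm_ge_zero not_less order_le_less zero_le_mult_iff)
  qed
  define S where "S f = Abs_ell2 (s f)" for f
  have sm: "(\<lambda>x. (cmod (s f x))\<^sup>2) summable_on UNIV" for f
  proof (rule nonneg_bdd_above_summable_on)
    show "bdd_above (sum (\<lambda>x. (cmod (s f x))\<^sup>2) ` {F. F \<subseteq> UNIV \<and> finite F})"
    proof (rule bdd_aboveI2)
      fix F :: "'a set" assume "F \<in> {F. F \<subseteq> UNIV \<and> finite F}"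
      then have "(L2_set (\<lambda>x. cmod (s f x)) F)\<^sup>2 \<le> (norm T * norm f)\<^sup>2"
        by (intro power_mono bound) (auto simp: L2_set_nonneg)
      then show "(\<Sum>x\<in>F. (cmod (s f x))\<^sup>2) \<le> (norm T * norm f)\<^sup>2"
        by (simp add: L2_set_def sum_nonneg)
    qed
  qed auto
  have cS: "coord (S f) x = s f x" for f x
    unfolding S_def using sm by (simp add: Abs_ell2_inverse)
  have nS: "norm (S f) \<le> norm f * norm T" for f
    by (rule norm_ell2_leI) (use bound in \<open>auto simp: cS mult.commute\<close>)
  have "bounded_linear S"
  proof (rule bounded_linear_intro)
    show "S (f + g) = S f + S g" for f g
      by (rule ell2_eqI) (simp add: cS s_def cinner_add_right)
    show "S (r *\<^sub>R f) = r *\<^sub>R S f" for f r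
    proof -
      have "r *\<^sub>R g = scale (of_real r) g" for g :: "'a ell2"
        by (rule ell2_eqI) simp
      then show ?thesis
        by (intro ell2_eqI) (simp add: cS s_def cinner_scale_right)
    qed
  qed (rule nS)
  then have ap: "blinfun_apply (Blinfun S) = S"
    by (rule bounded_linear_Blinfun_apply)
  have fin: "cinner (S f) (ind F g) = cinner f (T (ind F g))" if "finite F" for f g F
  proof -
    have "cinner (S f) (ket y) = cinner f (T (ket y))" for y
      using cinner_commute[of "S f" "ket y"] cinner_commute[of f "T (ket y)"] by (simp add: cS s_def)
    then show ?thesis
      using T that by (simp add: clin_sum_ket, simp add: ind_eq_sum_ket cinner_sum_right cinner_scale_right)
  qed
  have adjoint: "cinner (S f) g = cinner f (T g)" for f g
  proof -
    have "cmod (cinner (S f) g - cinner f (T g)) \<le> e" if e: "0 < e" for e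
    proof -
      \<comment> \<open>\<open>K\<close> dominates the dependence of both sides on \<open>g\<close>;
        its summand 1 keeps it positive.\<close>
      define K where "K = norm (S f) + norm f * norm T + 1"
      have K: "0 < K" unfolding K_def by (intro add_nonneg_pos) auto
      obtain F where F: "finite F" "norm (g - ind F g) < e / K"
        using ind_finite_dense[OF divide_pos_pos[OF e K], of g] by blast
      have "cinner (S f) g - cinner f (T g) =
          cinner (S f) (g - ind F g) - cinner f (T (g - ind F g))"
        using fin[OF F(1)] by (simp add: cinner_diff_right blinfun.diff_right)
      also have "cmod \<dots> \<le> norm (S f) * norm (g - ind F g) + norm f * norm (T (g - ind F g))"
        by (intro order_trans[OF norm_triangle_ineq4] add_mono cinner_cauchy_schwarz)
      also have "\<dots> \<le> norm (S f) * norm (g - ind F g) + norm f * (norm T * norm (g - ind F g))"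
        by (intro add_left_mono mult_left_mono norm_blinfun) auto
      also have "\<dots> \<le> K * norm (g - ind F g)"
        by (simp add: K_def algebra_simps)
      also have "\<dots> \<le> e"
        using F(2) K by (simp add: field_simps)
      finally show ?thesis .
    qed
    then have "cmod (cinner (S f) g - cinner f (T g)) \<le> 0"
      by (rule field_le_epsilon[where y = 0, simplified]) 
    then show ?thesis by simp
  qed
  have adj: "adj T = Blinfun S"
    by (rule adj_unique) (simp add: ap adjoint)
  show "cinner (adj T f) g = cinner f (T g)"
    by (simp add: adj ap adjoint)
  show "norm (adj T) \<le> norm T"
    using nS by (intro norm_blinfun_bound) (auto simp: adj ap mult.commute)
qed

lemma cinner_adj_right: "clin T \<Longrightarrow> cinner f (adj T g) = cinner (T f) g"
  by (metis cinner_adj_left cinner_commute)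

lemma clin_adj [simp]: "clin T \<Longrightarrow> clin (adj T)"
  unfolding clin_def[of "adj T"]
  by (auto intro!: ell2_cinner_eqI simp: cinner_adj_left cinner_scale_left)

lemma adj_diff: "clin S \<Longrightarrow> clin T \<Longrightarrow> adj (S - T) = adj S - adj T"
  by (rule adj_unique)
    (simp add: blinfun.diff_left cinner_diff_left cinner_diff_right cinner_adj_left)

lemma projection_idem: "projection p \<Longrightarrow> p (p f) = p f"
  by (metis projection_def blinfun_apply_blinfun_compose)

lemma projection_cinner: "clin p \<Longrightarrow> projection p \<Longrightarrow> cinner (p f) g = cinner f (p g)"
  by (metis projection_def cinner_adj_left)

text \<open>\<open>(norm (p f))^2\<close> equals the pairing of \<open>f\<close> with
  \<open>p f\<close>, so Cauchy-Schwarz leaves one factor \<open>norm (p f)\<close> to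
  cancel.\<close>

lemma norm_projection_le:
  assumes p: "clin p" "projection p" shows "norm p \<le> 1"
proof (rule norm_blinfun_bound)
  fix f
  have "cinner (p f) (p f) = cinner f (p f)"
    by (simp add: projection_cinner[OF p] projection_idem[OF p(2)])
  then have "cmod (cinner (p f) (p f)) \<le> norm f * norm (p f)"
    using cinner_cauchy_schwarz[of f "p f"] by simp
  then have "norm (p f) * norm (p f) \<le> norm f * norm (p f)"
    by (simp add: cinner_self norm_power power2_eq_square norm_mult)
  then show "norm (p f) \<le> 1 * norm f"
    by (metis mult_1 mult_le_cancel_right norm_ge_zero not_less order_le_less)
qed auto

subsection \<open>Marriage theorem and Foelner sets\<close>

text \<open>Rado's proof: a minimal subrelation satisfying Hall's condition is a function. Zorn's lemma is
  applied to the set \<open>D\<close> of deleted pairs; a chain is harmless because each finite \<open>J\<close> meets only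
  finitely many pairs.\<close>

lemma hall_marriage:
  fixes N :: "'i \<Rightarrow> 'b set"
  assumes fin: "\<And>i. i \<in> I \<Longrightarrow> finite (N i)"
    and hall: "\<And>J. J \<subseteq> I \<Longrightarrow> finite J \<Longrightarrow> card J \<le> card (\<Union>i\<in>J. N i)"
  obtains f where "inj_on f I" "\<And>i. i \<in> I \<Longrightarrow> f i \<in> N i"
proof -
  define \<Sigma> where "\<Sigma> = Sigma I N"
  define H where "H D \<longleftrightarrow> (\<forall>J. J \<subseteq> I \<longrightarrow> finite J \<longrightarrow> card J \<le> card ((\<Sigma> - D) `` J))" for D
  define \<D> where "\<D> = {D. D \<subseteq> \<Sigma> \<and> H D}"
  have fin_restr: "finite (\<Sigma> \<inter> J \<times> UNIV)" if "J \<subseteq> I" "finite J" for J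
  proof -
    have "\<Sigma> \<inter> J \<times> UNIV = Sigma J N"
      using that by (auto simp: \<Sigma>_def)
    then show ?thesis
      using that fin by auto
  qed
  have fin_im: "finite ((\<Sigma> - D) `` J)" if "J \<subseteq> I" "finite J" for J D
  proof (rule finite_subset)
    show "(\<Sigma> - D) `` J \<subseteq> snd ` (\<Sigma> \<inter> J \<times> UNIV)"
      by force
  qed (use fin_restr[OF that] in auto)
  have "{} \<in> \<D>"
  proof -
    have "\<Sigma> `` J = (\<Union>i\<in>J. N i)" if "J \<subseteq> I" for J
      using that by (auto simp: \<Sigma>_def)
    then show ?thesis
      using hall by (simp add: \<D>_def H_def)
  qed
  moreover have "\<Union>\<C> \<in> \<D>" if \<C>: "\<C> \<noteq> {}" "subset.chain \<D> \<C>" for \<C>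
  proof -
    have sub: "\<C> \<subseteq> \<D>"
      using \<C> by (auto simp: subset.chain_def)
    have "card J \<le> card ((\<Sigma> - \<Union>\<C>) `` J)" if J: "J \<subseteq> I" "finite J" for J
    proof -
      have "finite (\<Union>\<C> \<inter> (\<Sigma> \<inter> J \<times> UNIV))"
        using fin_restr[OF J] by (rule finite_Int[OF disjI2])
      then obtain D where D: "D \<in> \<C>" "\<Union>\<C> \<inter> (\<Sigma> \<inter> J \<times> UNIV) \<subseteq> D"
        using finite_subset_Union_chain[OF _ Int_lower1 \<C>] by metis
      then have "(\<Sigma> - \<Union>\<C>) `` J = (\<Sigma> - D) `` J"
        by blast
      moreover have "H D"
        using D(1) sub by (auto simp: \<D>_def)
      ultimately show ?thesis
        using J by (simp add: H_def)
    qed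
    moreover have "\<Union>\<C> \<subseteq> \<Sigma>"
      using sub by (auto simp: \<D>_def)
    ultimately show ?thesis
      by (simp add: \<D>_def H_def)
  qed
  ultimately obtain M where M: "M \<in> \<D>" "\<And>X. X \<in> \<D> \<Longrightarrow> M \<subseteq> X \<Longrightarrow> X = M"
    using subset_Zorn_nonempty[of \<D>] by blast
  define R where "R = \<Sigma> - M"
  have R: "card J \<le> card (R `` J)" if "J \<subseteq> I" "finite J" for J
    using M(1) that by (auto simp: \<D>_def H_def R_def)
  have finR: "finite (R `` J)" if "J \<subseteq> I" "finite J" for J
    using fin_im[OF that] by (simp add: R_def)
  \<comment> \<open>By maximality of \<open>M\<close>, deleting one more pair breaks Hall's
    condition at some set, which must contain \<open>i\<close>. \<open>J\<close> is that set without
    \<open>i\<close>, so the strict inequality weakens to \<open>\<le>\<close>.\<close>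
  have violation: "\<exists>J. J \<subseteq> I \<and> finite J \<and> i \<notin> J \<and> card (R `` J \<union> (R `` {i} - {x})) \<le> card J"
    if "(i, x) \<in> R" for i x
  proof -
    have "\<not> H (insert (i, x) M)"
      using M(1) M(2)[of "insert (i, x) M"] that by (auto simp: R_def \<D>_def)
    then obtain J where J: "J \<subseteq> I" "finite J" "card ((R - {(i, x)}) `` J) < card J"
      unfolding H_def R_def by (metis Diff_insert not_le)
    have "i \<in> J"
    proof (rule ccontr)
      assume "i \<notin> J"
      then have "(R - {(i, x)}) `` J = R `` J" by auto
      then show False using R[OF J(1,2)] J(3) by simp
    qed
    then have "(R - {(i, x)}) `` J = R `` (J - {i}) \<union> (R `` {i} - {x})"
      by auto
    moreover have "card J = Suc (card (J - {i}))"
      using \<open>i \<in> J\<close> J(2) by (metis card_Suc_Diff1)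
    ultimately show ?thesis
      using J by (intro exI[of _ "J - {i}"]) auto
  qed
  \<comment> \<open>Submodularity: the two violating sets satisfy
    \<open>card ?U + card ?V \<le> card J + card K\<close>, but Hall's condition for
    \<open>insert i (J \<union> K)\<close> and for \<open>J \<inter> K\<close> makes the left side
    larger by at least one.\<close>
  have unique: "x = y" if xy: "(i, x) \<in> R" "(i, y) \<in> R" for i x y
  proof (rule ccontr)
    assume "x \<noteq> y"
    obtain J K where J: "J \<subseteq> I" "finite J" "i \<notin> J" "card (R `` J \<union> (R `` {i} - {x})) \<le> card J"
      and K: "K \<subseteq> I" "finite K" "i \<notin> K" "card (R `` K \<union> (R `` {i} - {y})) \<le> card K"
      using violation xy by meson
    let ?U = "R `` J \<union> (R `` {i} - {x})" and ?V = "R `` K \<union> (R `` {i} - {y})"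
    have i: "i \<in> I"
      using xy by (auto simp: R_def \<Sigma>_def)
    have "card ?U + card ?V = card (?U \<union> ?V) + card (?U \<inter> ?V)"
      using i J K by (intro card_Un_Int finite_UnI finite_Diff finR) auto
    moreover have "Suc (card (J \<union> K)) \<le> card (?U \<union> ?V)"
    proof -
      have "?U \<union> ?V = R `` insert i (J \<union> K)"
        using \<open>x \<noteq> y\<close> by auto
      then show ?thesis
        using R[of "insert i (J \<union> K)"] i J K by simp
    qed
    moreover have "card (J \<inter> K) \<le> card (?U \<inter> ?V)"
    proof -
      have "card (J \<inter> K) \<le> card (R `` (J \<inter> K))"
        using J by (intro R) auto
      also have "\<dots> \<le> card (?U \<inter> ?V)"
        using i J K by (intro card_mono finite_Int disjI1 finite_UnI finite_Diff finR) auto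
      finally show ?thesis .
    qed
    moreover have "card J + card K = card (J \<union> K) + card (J \<inter> K)"
      using J K by (intro card_Un_Int)
    ultimately show False
      using J(4) K(4) by linarith
  qed
  have "\<exists>x. (i, x) \<in> R" if "i \<in> I" for i
  proof -
    have "card (R `` {i}) \<noteq> 0"
      using R[of "{i}"] that by simp
    then have "R `` {i} \<noteq> {}"
      by (metis card.empty)
    then show ?thesis by blast
  qed
  then obtain f where f: "\<And>i. i \<in> I \<Longrightarrow> (i, f i) \<in> R"
    by metis
  have im: "R `` {i} = {f i}" if "i \<in> I" for i
    using f[OF that] unique by blast
  show ?thesis
  proof
    show "inj_on f I"
    proof (rule inj_onI, rule ccontr)
      fix i j assume ij: "i \<in> I" "j \<in> I" "f i = f j" "i \<noteq> j"
      have "R `` {i, j} = {f i}"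
        using ij im[of i] im[of j] by auto
      then show False
        using R[of "{i, j}"] ij by simp
    qed
    show "f i \<in> N i" if "i \<in> I" for i
      using f[OF that] by (auto simp: R_def \<Sigma>_def)
  qed
qed

text \<open>The bijection is the one of the Schroeder--Bernstein argument; it agrees piecewise with \<open>f\<close> or
  with the projection \<open>(a, True) \<mapsto> a\<close>, so that displacements stay bounded.\<close>

lemma paradoxicalI:
  fixes A :: "'a::metric_space set"
  assumes inj: "inj_on f (A \<times> (UNIV :: bool set))"
    and f: "\<And>a b. a \<in> A \<Longrightarrow> f (a, b) \<in> A \<and> dist a (f (a, b)) \<le> R"
  shows "paradoxical A"
proof -
  define X where "X = A \<times> (UNIV :: bool set)"
  \<comment> \<open>\<open>\<phi>\<close> embeds \<open>X\<close> into its \<open>True\<close> half;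
    \<open>S\<close> collects all forward images of the \<open>False\<close> half, which
    \<open>\<phi>\<close> misses.\<close>
  define \<phi> where "\<phi> z = (f z, True)" for z
  define S where "S = (\<Union>n. (\<phi> ^^ n) ` (A \<times> {False}))"
  \<comment> \<open>Off \<open>S\<close> only points of the \<open>True\<close> half remain, where
    \<open>fst\<close> is injective; its values there avoid those of \<open>f\<close> on
    \<open>S\<close> because \<open>S\<close> is closed under \<open>\<phi>\<close>.\<close>
  define h where "h z = (if z \<in> S then f z else fst z)" for z
  have fA: "f z \<in> A" if "z \<in> X" for z
    using that f by (cases z) (auto simp: X_def)
  have pow: "(\<phi> ^^ n) z \<in> X" if "z \<in> A \<times> {False}" for n z
    using that by (induction n) (auto simp: X_def \<phi>_def fA[unfolded X_def])
  then have SX: "S \<subseteq> X"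
    unfolding S_def by blast
  have S_step: "(f z, True) \<in> S" if "z \<in> S" for z
  proof -
    obtain n w where "w \<in> A \<times> {False}" "z = (\<phi> ^^ n) w"
      using \<open>z \<in> S\<close> by (auto simp: S_def)
    then have "(f z, True) = (\<phi> ^^ Suc n) w"
      by (simp add: \<phi>_def)
    with \<open>w \<in> A \<times> {False}\<close> show ?thesis
      unfolding S_def by blast
  qed
  have S_False: "(a, False) \<in> S" if "a \<in> A" for a
    unfolding S_def using that by (intro UN_I[of 0]) auto
  have S_True: "\<exists>z\<in>S. f z = a" if a: "(a, True) \<in> S" for a
  proof -
    obtain n w where w: "w \<in> A \<times> {False}" "(a, True) = (\<phi> ^^ n) w"
      using a by (auto simp: S_def)
    then obtain m where "n = Suc m"
      by (cases n) auto
    then have "f ((\<phi> ^^ m) w) = a"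
      using w(2) by (simp add: \<phi>_def)
    moreover have "(\<phi> ^^ m) w \<in> S"
      unfolding S_def using w(1) by blast
    ultimately show ?thesis by blast
  qed
  have "bij_betw h X A"
    unfolding bij_betw_def
  proof
    have mixed: False if "z \<in> S" "z' \<in> X" "z' \<notin> S" "f z = fst z'" for z z'
    proof -
      have "z' = (f z, True)"
        using that S_False by (cases z', cases "snd z'") (auto simp: X_def)
      then show False
        using S_step[OF that(1)] that(3) by metis
    qed
    show "inj_on h X"
    proof (rule inj_onI)
      fix z z' assume z: "z \<in> X" "z' \<in> X" "h z = h z'"
      have "snd w = True" if "w \<in> X" "w \<notin> S" for w
        using that S_False[of "fst w"] by (cases w, cases "snd w") (auto simp: X_def)
      then show "z = z'"
        using z mixed[of z z'] mixed[of z' z] inj_onD[OF inj, of z z']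
        by (auto simp: h_def X_def prod_eq_iff split: if_splits)
    qed
    show "h ` X = A"
    proof
      show "h ` X \<subseteq> A"
        using fA by (auto simp: h_def X_def)
      show "A \<subseteq> h ` X"
      proof
        fix a assume a: "a \<in> A"
        show "a \<in> h ` X"
        proof (cases "(a, True) \<in> S")
          case True
          then obtain z where "z \<in> S" "f z = a"
            using S_True by blast
          then show ?thesis
            using SX by (intro image_eqI[of _ _ z]) (auto simp: h_def)
        next
          case False
          then show ?thesis
            using a by (intro image_eqI[of _ _ "(a, True)"]) (auto simp: h_def X_def)
        qed
      qed
    qed
  qed
  then have inj_h: "inj_on h X" and im_h: "h ` X = A"
    by (auto simp: bij_betw_def)
  \<comment> \<open>Points on which \<open>h\<close> is the projection do not move, which accounts
    for the 0.\<close>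
  have disp: "dist a (h (a, b)) \<le> max R 0" if "a \<in> A" for a b
    using f[OF that, of b] by (auto simp: h_def le_max_iff_disj)
  have pt: "partial_translation (\<lambda>a. h (a, b)) A ((\<lambda>a. h (a, b)) ` A)" for b
    unfolding partial_translation_def
  proof
    show "bij_betw (\<lambda>a. h (a, b)) A ((\<lambda>a. h (a, b)) ` A)"
      by (rule inj_on_imp_bij_betw) (use inj_h in \<open>auto simp: inj_on_def X_def\<close>)
    show "bdd_above ((\<lambda>a. dist a (h (a, b))) ` A)"
      by (rule bdd_aboveI2) (rule disp)
  qed
  have "A = (\<lambda>a. h (a, True)) ` A \<union> (\<lambda>a. h (a, False)) ` A"
  proof -
    have "X = (\<lambda>a. (a, True)) ` A \<union> (\<lambda>a. (a, False)) ` A"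
      by (auto simp: X_def UNIV_bool)
    then have "h ` X = (\<lambda>a. h (a, True)) ` A \<union> (\<lambda>a. h (a, False)) ` A"
      by (simp add: image_Un image_image)
    then show ?thesis
      unfolding im_h .
  qed
  moreover have "(\<lambda>a. h (a, True)) ` A \<inter> (\<lambda>a. h (a, False)) ` A = {}"
  proof -
    have "h (a, True) \<noteq> h (a', False)" if "a \<in> A" "a' \<in> A" for a a'
      using inj_onD[OF inj_h, of "(a, True)" "(a', False)"] that by (auto simp: X_def)
    then show ?thesis by blast
  qed
  ultimately show ?thesis
    unfolding paradoxical_def using pt[of True] pt[of False] by (intro exI conjI)
qed

section \<open>Foelner sets in non-paradoxical subspaces\<close>

definition nbhd :: "'a::metric_space set \<Rightarrow> real \<Rightarrow> 'a set \<Rightarrow> 'a set" where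
  "nbhd A R F = {y \<in> A. \<exists>x\<in>F. dist x y \<le> R}"

lemma bounded_geometryE:
  assumes "bounded_geometry TYPE('a::metric_space)"
  obtains N :: nat where "\<And>x::'a. finite (cball x R)" "\<And>x::'a. card (cball x R) \<le> N"
proof -
  obtain N :: nat where N: "\<And>x::'a. finite (cball x (max R 1)) \<and> card (cball x (max R 1)) \<le> N"
    using assms unfolding bounded_geometry_def by (metis less_max_iff_disj zero_less_one)
  have sub: "cball x R \<subseteq> cball x (max R 1)" for x :: 'a
    by auto
  show ?thesis
    using that[of N] N sub by (meson card_mono finite_subset order_trans)
qed

lemma finite_nbhd:
  fixes A :: "'a::metric_space set"
  assumes "bounded_geometry TYPE('a)" "finite F" shows "finite (nbhd A R F)"
proof -
  have "nbhd A R F \<subseteq> (\<Union>x\<in>F. cball x R)"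
    by (auto simp: nbhd_def)
  moreover have "finite (\<Union>x\<in>F. cball x R)"
    using assms by (auto elim: bounded_geometryE)
  ultimately show ?thesis
    by (rule finite_subset)
qed

text \<open>If all finite non-empty sets grew by the factor \<open>1 + e\<close>, iteration would
  make their \<open>m * R\<close>-neighbourhoods more than twice as large. This is Hall's condition
  for two copies of \<open>A\<close>, and the resulting injection has displacement at most
  \<open>m * R\<close>, so \<open>A\<close> would be paradoxical.\<close>

lemma folner_set:
  fixes A :: "'a::metric_space set" and e :: real
  assumes bg: "bounded_geometry TYPE('a)" and A: "A \<noteq> {}" "\<not> paradoxical A"
    and R: "0 \<le> R" and e: "0 < e"
  obtains F where "finite F" "F \<noteq> {}" "F \<subseteq> A" "card (nbhd A R F) \<le> (1 + e) * card F"
proof (rule ccontr)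
  note none = that
  assume "\<not> thesis"
  then have grow1: "(1 + e) * card F \<le> card (nbhd A R F)"
    if "finite F" "F \<noteq> {}" "F \<subseteq> A" for F
    using that none[of F] by (meson linear)
  have grow: "(1 + e) ^ m * card F \<le> card (nbhd A (m * R) F)"
    if F: "finite F" "F \<noteq> {}" "F \<subseteq> A" for m :: nat and F
  proof (induction m)
    case 0
    have "F \<subseteq> nbhd A (0 * R) F"
      using F(3) by (auto simp: nbhd_def)
    then show ?case
      using card_mono[OF finite_nbhd[OF bg F(1)]] by simp
  next
    case (Suc m)
    let ?G = "nbhd A (m * R) F"
    have "(1 + e) ^ Suc m * card F = (1 + e) * ((1 + e) ^ m * card F)"
      by simp
    also have "\<dots> \<le> (1 + e) * card ?G"
      using e Suc.IH by (intro mult_left_mono) auto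
    also have "\<dots> \<le> card (nbhd A R ?G)"
    proof (rule grow1)
      show "finite ?G" by (rule finite_nbhd[OF bg F(1)])
      have "F \<subseteq> ?G" using F(3) R by (force simp: nbhd_def)
      with F(2) show "?G \<noteq> {}" by auto
    qed (auto simp: nbhd_def)
    also have "\<dots> \<le> card (nbhd A (Suc m * R) F)"
    proof -
      have "nbhd A R ?G \<subseteq> nbhd A (Suc m * R) F"
      proof
        fix z assume "z \<in> nbhd A R ?G"
        then obtain x y where "x \<in> F" "dist x y \<le> m * R" "dist y z \<le> R" "z \<in> A"
          by (auto simp: nbhd_def)
        moreover have "dist x z \<le> dist x y + dist y z"
          by (rule dist_triangle)
        ultimately show "z \<in> nbhd A (Suc m * R) F"
          by (force simp: nbhd_def algebra_simps)
      qed
      then show ?thesis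
        using card_mono[OF finite_nbhd[OF bg F(1)]] by simp
    qed
    finally show ?case .
  qed
  obtain m where m: "2 < (1 + e) ^ m"
    using real_arch_pow[of "1 + e" 2] e by auto
  obtain f :: "'a \<times> bool \<Rightarrow> 'a" where f: "inj_on f (A \<times> UNIV)"
    "\<And>i. i \<in> A \<times> UNIV \<Longrightarrow> f i \<in> nbhd A (m * R) {fst i}"
  proof (rule hall_marriage[of "A \<times> (UNIV :: bool set)" "\<lambda>i. nbhd A (m * R) {fst i}"])
    show "finite (nbhd A (m * R) {fst i})" for i :: "'a \<times> bool"
      by (rule finite_nbhd[OF bg]) simp
    fix J :: "('a \<times> bool) set" assume J: "J \<subseteq> A \<times> UNIV" "finite J"
    \<comment> \<open>Both copies of a point share their neighbourhood, so only the projection of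
      \<open>J\<close> to \<open>A\<close> counts; it has at least \<open>card J / 2\<close>
      elements.\<close>
    have un: "(\<Union>i\<in>J. nbhd A (m * R) {fst i}) = nbhd A (m * R) (fst ` J)"
      by (auto simp: nbhd_def)
    show "card J \<le> card (\<Union>i\<in>J. nbhd A (m * R) {fst i})"
    proof (cases "J = {}")
      case False
      have "card J \<le> card (fst ` J \<times> (UNIV :: bool set))"
        using J by (intro card_mono) force+
      also have "\<dots> = 2 * card (fst ` J)"
        by (simp add: card_cartesian_product)
      finally have "real (card J) \<le> 2 * real (card (fst ` J))"
        by linarith
      also have "\<dots> \<le> (1 + e) ^ m * card (fst ` J)"
        using m by (intro mult_right_mono) auto
      also have "\<dots> \<le> card (nbhd A (m * R) (fst ` J))"
        using J False by (intro grow) auto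
      finally show ?thesis
        by (simp add: un)
    qed simp
  qed blast
  have "paradoxical A"
  proof (rule paradoxicalI[OF f(1)])
    show "f (a, b) \<in> A \<and> dist a (f (a, b)) \<le> m * R" if "a \<in> A" for a b
      using f(2)[of "(a, b)"] that by (auto simp: nbhd_def)
  qed
  with A show False by simp
qed

subsection \<open>Finite propagation and asymptotic traces\<close>

text \<open>Finite propagation is expressed through supports, which makes it evidently stable under
  composition.\<close>

definition has_prop :: "real \<Rightarrow> 'a::metric_space op2 \<Rightarrow> bool" where
  "has_prop R T \<longleftrightarrow> (\<forall>f x. (\<forall>y. dist x y \<le> R \<longrightarrow> coord f y = 0) \<longrightarrow> coord (T f) x = 0)"

lemma has_prop_mono: "has_prop R T \<Longrightarrow> R \<le> S \<Longrightarrow> has_prop S T"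
  unfolding has_prop_def by (meson order_trans)

lemma has_prop_compose:
  fixes S T :: "'a::metric_space op2"
  assumes "has_prop R S" "has_prop R' T" shows "has_prop (R + R') (S o\<^sub>L T)"
  unfolding has_prop_def
proof (intro allI impI)
  fix f :: "'a ell2" and x assume f: "\<forall>y. dist x y \<le> R + R' \<longrightarrow> coord f y = 0"
  have "coord (T f) y = 0" if "dist x y \<le> R" for y
  proof -
    have "coord f z = 0" if "dist y z \<le> R'" for z
      using f dist_triangle[of x z y] \<open>dist x y \<le> R\<close> that by auto
    then show ?thesis
      using assms(2) by (simp add: has_prop_def)
  qed
  then show "coord ((S o\<^sub>L T) f) x = 0"
    using assms(1) by (simp add: has_prop_def)
qed

lemma has_prop_entry: "has_prop R T \<Longrightarrow> R < dist x y \<Longrightarrow> coord (T (ket y)) x = 0"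
  unfolding has_prop_def by (auto simp: not_le[symmetric])

text \<open>Row \<open>x\<close> does not see \<open>f\<close> outside the ball, and inside it
  complex linearity expands \<open>f\<close> into finitely many basis vectors.\<close>

lemma coord_eq_sum_entries:
  assumes T: "clin T" "has_prop R T" and fin: "finite (cball x R)"
  shows "coord (T f) x = (\<Sum>y\<in>cball x R. coord (T (ket y)) x * coord f y)"
proof -
  have "coord (T (f - ind (cball x R) f)) x = 0"
    using T(2) by (simp add: has_prop_def)
  then have "coord (T f) x = coord (T (ind (cball x R) f)) x"
    by (simp add: blinfun.diff_right)
  then show ?thesis
    by (simp add: clin_sum_ket[OF T(1) fin] mult.commute)
qed

text \<open>Coordinate \<open>x\<close> of the adjoint pairs \<open>f\<close> with the column
  \<open>T (ket x)\<close>, which lives on the ball around \<open>x\<close>.\<close>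

lemma has_prop_adj:
  fixes T :: "'a::metric_space op2"
  assumes "clin T" "has_prop R T" shows "has_prop R (adj T)"
  unfolding has_prop_def
proof (intro allI impI)
  fix f :: "'a ell2" and x assume f: "\<forall>y. dist x y \<le> R \<longrightarrow> coord f y = 0"
  have "coord (T (ket x)) y = 0 \<or> coord f y = 0" for y
    using f has_prop_entry[OF assms(2), of y x] by (metis dist_commute not_le)
  then have "cinner (T (ket x)) f = 0"
    unfolding cinner_def by (intro infsum_0) auto
  then show "coord (adj T f) x = 0"
    using cinner_adj_right[OF assms(1), of "ket x" f] by simp
qed

lemma cmod_entry_le:
  fixes T :: "'a op2"
  shows "cmod (coord (T (ket y)) x) \<le> norm T"
  using cmod_coord_le[of "T (ket y)" x] norm_blinfun[of T "ket y"] by simp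

text \<open>The norm bound is the Schur test.\<close>

lemma matrix_operator:
  fixes a :: "'a::metric_space \<Rightarrow> 'a \<Rightarrow> complex" and N :: nat
  assumes fin: "\<And>x::'a. finite (cball x R)" and N: "\<And>x::'a. card (cball x R) \<le> N"
    and C: "\<And>x y. cmod (a x y) \<le> C" and supp: "\<And>x y. R < dist x y \<Longrightarrow> a x y = 0"
  obtains T :: "'a op2" where "clin T" "has_prop R T" "norm T \<le> C * N"
    "\<And>x y. coord (T (ket y)) x = a x y"
proof -
  have C0: "0 \<le> C"
    using C norm_ge_zero order_trans by blast
  define s where "s f x = (\<Sum>y\<in>cball x R. a x y * coord f y)" for f x
  have row: "(cmod (s f x))\<^sup>2 \<le> C\<^sup>2 * N * (\<Sum>y\<in>cball x R. (cmod (coord f y))\<^sup>2)" for f x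
  proof -
    have "cmod (s f x) \<le> (\<Sum>y\<in>cball x R. \<bar>C\<bar> * \<bar>cmod (coord f y)\<bar>)"
      unfolding s_def by (intro sum_norm_le) (use C C0 in \<open>auto simp: norm_mult intro: mult_right_mono\<close>)
    also have "\<dots> \<le> L2_set (\<lambda>_. C) (cball x R) * L2_set (\<lambda>y. cmod (coord f y)) (cball x R)"
      by (rule L2_set_mult_ineq)
    finally have "(cmod (s f x))\<^sup>2 \<le>
        (L2_set (\<lambda>_. C) (cball x R) * L2_set (\<lambda>y. cmod (coord f y)) (cball x R))\<^sup>2"
      by (intro power_mono) auto
    also have "\<dots> = card (cball x R) * C\<^sup>2 * (\<Sum>y\<in>cball x R. (cmod (coord f y))\<^sup>2)"
      unfolding L2_set_def power_mult_distrib by (simp add: sum_nonneg)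
    also have "\<dots> \<le> N * C\<^sup>2 * (\<Sum>y\<in>cball x R. (cmod (coord f y))\<^sup>2)"
      using N[of x] by (intro mult_right_mono sum_nonneg) auto
    finally show ?thesis
      by (simp add: mult_ac)
  qed
  \<comment> \<open>After interchanging the sums, a point \<open>y\<close> is met by at most
    \<open>N\<close> rows because \<open>dist\<close> is symmetric. The other factor
    \<open>N\<close> comes from Cauchy-Schwarz within a row.\<close>
  have bound: "(\<Sum>x\<in>F. (cmod (s f x))\<^sup>2) \<le> (C * N * norm f)\<^sup>2" if F: "finite F" for f F
  proof -
    let ?G = "\<Union>x\<in>F. cball x R" and ?w = "\<lambda>y. (cmod (coord f y))\<^sup>2"
    have G: "finite ?G"
      using F fin by auto
    have "(\<Sum>x\<in>F. (cmod (s f x))\<^sup>2) \<le> (\<Sum>x\<in>F. C\<^sup>2 * N * (\<Sum>y\<in>cball x R. ?w y))"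
      by (intro sum_mono row)
    also have "\<dots> = C\<^sup>2 * N * (\<Sum>x\<in>F. \<Sum>y\<in>?G. if y \<in> cball x R then ?w y else 0)"
    proof -
      have "(\<Sum>y\<in>cball x R. ?w y) = (\<Sum>y\<in>?G. if y \<in> cball x R then ?w y else 0)" if "x \<in> F" for x
        using that by (intro sum.mono_neutral_cong_left G) auto
      then show ?thesis
        by (simp add: sum_distrib_left cong: sum.cong)
    qed
    also have "(\<Sum>x\<in>F. \<Sum>y\<in>?G. if y \<in> cball x R then ?w y else 0) =
        (\<Sum>y\<in>?G. \<Sum>x\<in>F. if y \<in> cball x R then ?w y else 0)"
      by (rule sum.swap)
    also have "\<dots> \<le> (\<Sum>y\<in>?G. N * ?w y)"
    proof (rule sum_mono)
      fix y
      have "(\<Sum>x\<in>F. if y \<in> cball x R then ?w y else 0) = (\<Sum>x\<in>F. if x \<in> cball y R then ?w y else 0)"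
        by (simp add: dist_commute)
      also have "\<dots> = (\<Sum>x\<in>F \<inter> cball y R. ?w y)"
        by (rule sum.inter_restrict[OF F, symmetric])
      also have "\<dots> = card (F \<inter> cball y R) * ?w y"
        by simp
      also have "\<dots> \<le> N * ?w y"
        using order_trans[OF card_mono[OF fin Int_lower2] N] by (intro mult_right_mono) auto
      finally show "(\<Sum>x\<in>F. if y \<in> cball x R then ?w y else 0) \<le> N * ?w y" .
    qed
    also have "\<dots> = N * (L2_set (\<lambda>y. cmod (coord f y)) ?G)\<^sup>2"
      by (simp add: L2_set_def sum_nonneg sum_distrib_left)
    also have "\<dots> \<le> N * (norm f)\<^sup>2"
      using L2_set_le_norm_ell2[OF G, of f] by (intro mult_left_mono power_mono) (auto simp: L2_set_nonneg)
    finally have "(\<Sum>x\<in>F. (cmod (s f x))\<^sup>2) \<le> C\<^sup>2 * N * (N * (norm f)\<^sup>2)"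
      by (simp add: mult_left_mono)
    then show ?thesis
      by (simp add: power2_eq_square mult_ac)
  qed
  define S where "S f = Abs_ell2 (s f)" for f
  have cS: "coord (S f) x = s f x" for f x
  proof -
    have "(\<lambda>x. (cmod (s f x))\<^sup>2) summable_on UNIV"
      by (intro nonneg_bdd_above_summable_on bdd_aboveI2) (use bound in auto)
    then show ?thesis
      unfolding S_def by (simp add: Abs_ell2_inverse)
  qed
  have nS: "norm (S f) \<le> norm f * (C * N)" for f
  proof (rule norm_ell2_leI)
    fix F :: "'a set" assume "finite F"
    from bound[OF this, of f] show "L2_set (\<lambda>x. cmod (coord (S f) x)) F \<le> norm f * (C * N)"
      using C0 by (auto simp: L2_set_def cS mult_ac intro!: real_le_lsqrt sum_nonneg)
  qed (use C0 in auto)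
  have "bounded_linear S"
  proof (rule bounded_linear_intro)
    show "S (f + g) = S f + S g" "S (r *\<^sub>R f) = r *\<^sub>R S f" for f g r
      by (auto intro!: ell2_eqI simp: cS s_def algebra_simps sum.distrib sum_distrib_left)
  qed (rule nS)
  then have ap: "blinfun_apply (Blinfun S) = S"
    by (rule bounded_linear_Blinfun_apply)
  show ?thesis
  proof
    show "clin (Blinfun S)"
      by (auto intro!: ell2_eqI simp: clin_def ap cS s_def sum_distrib_left mult_ac)
    show "has_prop R (Blinfun S)"
      by (auto simp: has_prop_def ap cS s_def)
    show "norm (Blinfun S) \<le> C * N"
      using nS C0 by (intro norm_blinfun_bound) (auto simp: ap mult.commute)
    show "coord (Blinfun S (ket y)) x = a x y" for x y
      using supp[of x y] fin[of x] by (auto simp: ap cS s_def if_distrib sum.delta cong: if_cong)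
  qed
qed

text \<open>Rows determine a finite propagation operator, so \<open>matrix_operator\<close> applied
  to the entries of \<open>T\<close> returns \<open>T\<close> itself, together with the Schur
  bound.\<close>

lemma norm_has_prop_le:
  fixes T :: "'a::metric_space op2" and N :: nat
  assumes T: "clin T" "has_prop R T"
    and fin: "\<And>x::'a. finite (cball x R)" and N: "\<And>x::'a. card (cball x R) \<le> N"
    and C: "\<And>x y. cmod (coord (T (ket y)) x) \<le> C"
  shows "norm T \<le> C * N"
proof -
  obtain S :: "'a op2" where S: "clin S" "has_prop R S" "norm S \<le> C * N"
    "\<And>x y. coord (S (ket y)) x = coord (T (ket y)) x"
    by (rule matrix_operator[OF fin N C has_prop_entry[OF T(2)]]) (assumption | rule that)+
  have "coord (S f) x = coord (T f) x" for f x
    using coord_eq_sum_entries[OF S(1,2) fin, of f x] coord_eq_sum_entries[OF T fin, of f x]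
    by (simp add: S(4))
  then have "S = T"
    by (intro blinfun_eqI ell2_eqI)
  with S(3) show ?thesis by simp
qed

text \<open>Entries are bounded by the operator norm, and finite balls turn the infinite row sums
  into finite ones; hence the matrix can be recovered from the operator.\<close>

lemma algebraic_roe_algebra_iff:
  fixes T :: "'a::metric_space op2"
  assumes bg: "bounded_geometry TYPE('a)"
  shows "T \<in> algebraic_roe_algebra \<longleftrightarrow> clin T \<and> (\<exists>R. has_prop R T)"
proof
  assume "T \<in> algebraic_roe_algebra"
  then obtain a where a: "finite_propagation a" "\<And>f x. coord (T f) x = (\<Sum>\<^sub>\<infinity>y. a x y * coord f y)"
    by (auto simp: algebraic_roe_algebra_def)
  obtain R where R: "\<And>x y. a x y \<noteq> 0 \<Longrightarrow> dist x y \<le> R"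
    using a(1) by (auto simp: finite_propagation_def bdd_above_def)
  have "clin T"
    unfolding clin_def
    by (auto intro!: ell2_eqI simp: a(2) infsum_cmult_right'[symmetric] mult.left_commute)
  moreover have "has_prop R T"
    unfolding has_prop_def a(2) by (intro allI impI infsum_0) (use R in auto)
  ultimately show "clin T \<and> (\<exists>R. has_prop R T)"
    by blast
next
  assume "clin T \<and> (\<exists>R. has_prop R T)"
  then obtain R where T: "clin T" "has_prop R T"
    by blast
  define a where "a x y = coord (T (ket y)) x" for x y
  have fin: "finite (cball x R)" for x :: 'a
    using bg by (auto elim: bounded_geometryE)
  have "coord (T f) x = (\<Sum>\<^sub>\<infinity>y. a x y * coord f y)" for f x
  proof -
    have "coord (T f) x = (\<Sum>\<^sub>\<infinity>y\<in>cball x R. a x y * coord f y)"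
      using coord_eq_sum_entries[OF T fin, of f x] fin by (simp add: a_def)
    also have "\<dots> = (\<Sum>\<^sub>\<infinity>y. a x y * coord f y)"
      using has_prop_entry[OF T(2)] by (intro infsum_cong_neutral) (auto simp: a_def)
    finally show ?thesis .
  qed
  moreover have "bounded_entries a"
    unfolding bounded_entries_def a_def by (intro exI[of _ "norm T"] allI cmod_entry_le)
  moreover have "finite_propagation a"
  proof -
    have "dist x y \<le> R" if "a x y \<noteq> 0" for x y
      using has_prop_entry[OF T(2), of x y] that by (auto simp: a_def not_le[symmetric])
    then show ?thesis
      unfolding finite_propagation_def by (intro bdd_aboveI[of _ R]) auto
  qed
  ultimately show "T \<in> algebraic_roe_algebra"
    unfolding algebraic_roe_algebra_def by (intro CollectI exI[of _ a]) simp
qed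

section \<open>Approximation and closure properties of the uniform Roe algebra\<close>

lemma uniform_roe_algebraE:
  assumes "bounded_geometry TYPE('a)" "(T :: 'a::metric_space op2) \<in> uniform_roe_algebra"
  obtains S R where "\<And>n. clin (S n)" "\<And>n. has_prop (R n) (S n)" "S \<longlonglongrightarrow> T"
proof -
  obtain S where "\<forall>n. S n \<in> algebraic_roe_algebra" "S \<longlonglongrightarrow> T"
    using assms(2) unfolding uniform_roe_algebra_def closure_sequential by blast
  then show ?thesis
    using that unfolding algebraic_roe_algebra_iff[OF assms(1)] by metis
qed

lemma uniform_roe_algebraI:
  assumes "bounded_geometry TYPE('a)" "\<And>n. clin (S n)" "\<And>n. has_prop (R n) (S n)"
    and "S \<longlonglongrightarrow> (T :: 'a::metric_space op2)"
  shows "T \<in> uniform_roe_algebra"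
  unfolding uniform_roe_algebra_def closure_sequential
  using assms(2-4) by (auto simp: algebraic_roe_algebra_iff[OF assms(1)])

lemma clin_uniform_roe_algebra:
  assumes bg: "bounded_geometry TYPE('a)" and T: "(T :: 'a::metric_space op2) \<in> uniform_roe_algebra"
  shows "clin T"
proof -
  have "uniform_roe_algebra \<subseteq> {T :: 'a op2. clin T}"
    unfolding uniform_roe_algebra_def
    by (rule closure_minimal[OF _ closed_clin]) (auto simp: algebraic_roe_algebra_iff[OF bg])
  with T show ?thesis by blast
qed

lemma uniform_roe_algebra_has_prop:
  assumes "bounded_geometry TYPE('a)" "clin T" "has_prop R (T :: 'a::metric_space op2)"
  shows "T \<in> uniform_roe_algebra"
  using assms by (intro uniform_roe_algebraI[of "\<lambda>_. T" "\<lambda>_. R"]) auto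

lemma uniform_roe_algebra_ind:
  assumes "bounded_geometry TYPE('a)"
  shows "ind A \<in> (uniform_roe_algebra :: 'a::metric_space op2 set)"
  using assms by (rule uniform_roe_algebra_has_prop[where R = 0]) (auto simp: has_prop_def)

lemma uniform_roe_algebra_add:
  fixes S T :: "'a::metric_space op2"
  assumes bg: "bounded_geometry TYPE('a)" and S: "S \<in> uniform_roe_algebra" and T: "T \<in> uniform_roe_algebra"
  shows "S + T \<in> uniform_roe_algebra"
proof -
  obtain s R where s: "\<And>n. clin (s n)" "\<And>n. has_prop (R n) (s n)" "s \<longlonglongrightarrow> S"
    by (rule uniform_roe_algebraE[OF bg S]) (rule that)
  obtain t R' where t: "\<And>n. clin (t n)" "\<And>n. has_prop (R' n) (t n)" "t \<longlonglongrightarrow> T"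
    by (rule uniform_roe_algebraE[OF bg T]) (rule that)
  have "has_prop (max (R n) (R' n)) (s n + t n)" for n
    using has_prop_mono[OF s(2), of n "max (R n) (R' n)"] has_prop_mono[OF t(2), of n "max (R n) (R' n)"]
    by (simp add: has_prop_def blinfun.add_left)
  then show ?thesis
    using s(1) t(1) by (intro uniform_roe_algebraI[OF bg _ _ tendsto_add[OF s(3) t(3)]]) auto
qed

lemma uniform_roe_algebra_compose:
  fixes S T :: "'a::metric_space op2"
  assumes bg: "bounded_geometry TYPE('a)" and S: "S \<in> uniform_roe_algebra" and T: "T \<in> uniform_roe_algebra"
  shows "S o\<^sub>L T \<in> uniform_roe_algebra"
proof -
  obtain s R where s: "\<And>n. clin (s n)" "\<And>n. has_prop (R n) (s n)" "s \<longlonglongrightarrow> S"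
    by (rule uniform_roe_algebraE[OF bg S]) (rule that)
  obtain t R' where t: "\<And>n. clin (t n)" "\<And>n. has_prop (R' n) (t n)" "t \<longlonglongrightarrow> T"
    by (rule uniform_roe_algebraE[OF bg T]) (rule that)
  have "(\<lambda>n. s n o\<^sub>L t n) \<longlonglongrightarrow> (S o\<^sub>L T)"
    by (rule bounded_bilinear.tendsto[OF bounded_bilinear_blinfun_compose s(3) t(3)])
  then show ?thesis
    using s(1) t(1) by (intro uniform_roe_algebraI[OF bg, where R = "\<lambda>n. R n + R' n"])
      (auto intro: has_prop_compose s t)
qed

lemma uniform_roe_algebra_adj:
  fixes T :: "'a::metric_space op2"
  assumes bg: "bounded_geometry TYPE('a)" and T: "T \<in> uniform_roe_algebra"
  shows "adj T \<in> uniform_roe_algebra"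
proof -
  obtain s R where s: "\<And>n. clin (s n)" "\<And>n. has_prop (R n) (s n)" "s \<longlonglongrightarrow> T"
    by (rule uniform_roe_algebraE[OF bg T]) (rule that)
  have "(\<lambda>n. adj (s n)) \<longlonglongrightarrow> adj T"
  proof (rule Lim_transform_bound[OF _ LIM_zero[OF s(3)], THEN LIM_zero_cancel])
    show "\<forall>\<^sub>F n in sequentially. norm (adj (s n) - adj T) \<le> norm (s n - T)"
      using s(1) clin_uniform_roe_algebra[OF assms]
      by (intro always_eventually allI) (simp add: norm_adj_le flip: adj_diff)
  qed
  then show ?thesis
    using s by (intro uniform_roe_algebraI[OF bg, where R = R]) (auto intro: has_prop_adj)
qed

section \<open>Averaged diagonal entries as asymptotic traces\<close>

definition tr :: "'a set \<Rightarrow> 'a op2 \<Rightarrow> complex" where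
  "tr F T = (\<Sum>x\<in>F. coord (T (ket x)) x) / of_nat (card F)"

lemma tr_add: "tr F (S + T) = tr F S + tr F T"
  by (simp add: tr_def blinfun.add_left sum.distrib add_divide_distrib)

lemma tr_diff: "tr F (S - T) = tr F S - tr F T"
  by (simp add: tr_def blinfun.diff_left sum_subtractf diff_divide_distrib)

text \<open>For finite non-empty \<open>F\<close>, \<open>tr F\<close> is the normalised trace of
  the compression to \<open>F\<close>. A bound uniform in \<open>F\<close> lets asymptotic
  statements pass to norm limits of operators.\<close>

lemma cmod_tr_le: "cmod (tr F T) \<le> norm T"
proof (cases "card F = 0")
  case False
  have "cmod (\<Sum>x\<in>F. coord (T (ket x)) x) \<le> (\<Sum>x\<in>F. norm T)"
    by (intro sum_norm_le cmod_entry_le)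
  then show ?thesis
    using False by (simp add: tr_def norm_divide divide_le_eq mult.commute)
qed (simp add: tr_def)

text \<open>Both diagonals expand into sums over an intermediate index \<open>y\<close> in
  \<open>nbhd A R F\<close>. Terms with \<open>y\<close> in \<open>F\<close> cancel after
  interchanging the sums; an index \<open>y\<close> outside \<open>F\<close> meets at most
  \<open>N\<close> points of \<open>F\<close>, once for each of the two products.\<close>

lemma tr_commutator_le:
  fixes u v :: "'a::metric_space op2" and N :: nat
  assumes u: "clin u" "has_prop R u" and v: "clin v" "has_prop R v"
    and fin: "\<And>x::'a. finite (cball x R)" and N: "\<And>x::'a. card (cball x R) \<le> N"
    and F: "finite F" "F \<subseteq> A" and R: "0 \<le> R"
  shows "cmod (tr F (u o\<^sub>L ind A o\<^sub>L v) - tr F (v o\<^sub>L ind A o\<^sub>L u)) * card F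
    \<le> 2 * (card (nbhd A R F - F) * (N * (norm u * norm v)))"
proof -
  define G where "G = nbhd A R F"
  have "nbhd A R F \<subseteq> (\<Union>x\<in>F. cball x R)"
    by (auto simp: nbhd_def)
  then have G: "finite G"
    unfolding G_def by (rule finite_subset) (use F fin in auto)
  have FG: "F \<subseteq> G"
    using F(2) R by (auto simp: G_def nbhd_def intro!: bexI)
  \<comment> \<open>\<open>ind A\<close> puts the intermediate index into \<open>A\<close> and the
    propagation of \<open>s\<close> puts it near \<open>x\<close>, so \<open>G\<close> serves both
    orders of the product.\<close>
  have entry: "coord ((s o\<^sub>L ind A o\<^sub>L t) (ket x)) x =
      (\<Sum>y\<in>G. coord (s (ket y)) x * coord (t (ket x)) y)"
    if s: "clin s" "has_prop R s" and x: "x \<in> F" for s t :: "'a op2" and x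
  proof -
    have "coord ((s o\<^sub>L ind A o\<^sub>L t) (ket x)) x =
        (\<Sum>y\<in>cball x R. coord (s (ket y)) x * (if y \<in> A then coord (t (ket x)) y else 0))"
      using coord_eq_sum_entries[OF s fin, of "ind A (t (ket x))" x] by simp
    also have "\<dots> = (\<Sum>y\<in>G. coord (s (ket y)) x * coord (t (ket x)) y)"
    proof (rule sum.mono_neutral_cong[OF G fin])
      show "coord (s (ket y)) x * coord (t (ket x)) y = 0" if "y \<in> G - cball x R" for y
        using that has_prop_entry[OF s(2)] by (auto simp: not_le)
    qed (use x in \<open>auto simp: G_def nbhd_def\<close>)
    finally show ?thesis .
  qed
  define \<phi> where "\<phi> x y = coord (u (ket y)) x * coord (v (ket x)) y" for x y
  let ?D = "G - F"
  have D: "cmod (\<Sum>x\<in>F. \<Sum>y\<in>?D. \<psi> x y) \<le> card ?D * (N * (norm u * norm v))"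
    if \<psi>: "\<And>x y. cmod (\<psi> x y) \<le> norm u * norm v" "\<And>x y. R < dist x y \<Longrightarrow> \<psi> x y = 0" for \<psi>
  proof -
    have "cmod (\<Sum>x\<in>F. \<psi> x y) \<le> N * (norm u * norm v)" for y
    proof -
      have "(\<Sum>x\<in>F. \<psi> x y) = (\<Sum>x\<in>F \<inter> cball y R. \<psi> x y)"
        using F \<psi>(2) by (intro sum.mono_neutral_right) (auto simp: dist_commute not_le)
      also have "cmod \<dots> \<le> (\<Sum>x\<in>F \<inter> cball y R. norm u * norm v)"
        by (intro sum_norm_le \<psi>(1))
      also have "\<dots> = card (F \<inter> cball y R) * (norm u * norm v)"
        by simp
      also have "\<dots> \<le> N * (norm u * norm v)"
        using order_trans[OF card_mono[OF fin Int_lower2] N] by (intro mult_right_mono) auto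
      finally show ?thesis .
    qed
    then have "cmod (\<Sum>y\<in>?D. \<Sum>x\<in>F. \<psi> x y) \<le> (\<Sum>y\<in>?D. N * (norm u * norm v))"
      by (intro sum_norm_le)
    then show ?thesis
      by (subst sum.swap) simp
  qed
  have \<phi>: "cmod (\<phi> x y) \<le> norm u * norm v" for x y
    unfolding \<phi>_def norm_mult by (intro mult_mono cmod_entry_le) auto
  have \<phi>0: "\<phi> x y = 0" if "R < dist x y" for x y
    using has_prop_entry[OF u(2) that] by (simp add: \<phi>_def)
  have "(\<Sum>x\<in>F. coord ((u o\<^sub>L ind A o\<^sub>L v) (ket x)) x) - (\<Sum>x\<in>F. coord ((v o\<^sub>L ind A o\<^sub>L u) (ket x)) x) =
      (\<Sum>x\<in>F. \<Sum>y\<in>G. \<phi> x y) - (\<Sum>x\<in>F. \<Sum>y\<in>G. \<phi> y x)"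
    by (simp only: entry[OF u] entry[OF v] \<phi>_def mult.commute cong: sum.cong)
  also have "(\<Sum>x\<in>F. \<Sum>y\<in>G. \<phi> x y) = (\<Sum>x\<in>F. \<Sum>y\<in>F. \<phi> x y) + (\<Sum>x\<in>F. \<Sum>y\<in>?D. \<phi> x y)"
    by (simp add: sum.subset_diff[OF FG G] sum.distrib add.commute)
  also have "(\<Sum>x\<in>F. \<Sum>y\<in>G. \<phi> y x) = (\<Sum>x\<in>F. \<Sum>y\<in>F. \<phi> y x) + (\<Sum>x\<in>F. \<Sum>y\<in>?D. \<phi> y x)"
    by (simp add: sum.subset_diff[OF FG G] sum.distrib add.commute)
  also have "(\<Sum>x\<in>F. \<Sum>y\<in>F. \<phi> y x) = (\<Sum>x\<in>F. \<Sum>y\<in>F. \<phi> x y)"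
    by (rule sum.swap)
  finally have "cmod ((\<Sum>x\<in>F. coord ((u o\<^sub>L ind A o\<^sub>L v) (ket x)) x) -
        (\<Sum>x\<in>F. coord ((v o\<^sub>L ind A o\<^sub>L u) (ket x)) x)) =
      cmod ((\<Sum>x\<in>F. \<Sum>y\<in>?D. \<phi> x y) - (\<Sum>x\<in>F. \<Sum>y\<in>?D. \<phi> y x))"
    by simp
  also have "\<dots> \<le> card ?D * (N * (norm u * norm v)) + card ?D * (N * (norm u * norm v))"
    by (intro order_trans[OF norm_triangle_ineq4] add_mono D \<phi>)
      (auto simp: \<phi>0 dist_commute)
  finally show ?thesis
    unfolding tr_def diff_divide_distrib[symmetric] norm_divide G_def by (cases "card F = 0") (auto simp: mult_ac)
qed

text \<open>Radius \<open>n\<close> and tolerance \<open>1 / Suc n\<close> vary together, so a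
  single sequence eventually handles every propagation bound. General \<open>u\<close> and
  \<open>v\<close> are replaced by finite propagation approximants at a cost uniform in
  \<open>n\<close>.\<close>

lemma folner_sequence:
  fixes A :: "'a::metric_space set"
  assumes bg: "bounded_geometry TYPE('a)" and A: "A \<noteq> {}" "\<not> paradoxical A"
  obtains F :: "nat \<Rightarrow> 'a set" where "\<And>n. finite (F n)" "\<And>n. F n \<noteq> {}" "\<And>n. F n \<subseteq> A"
    "\<And>u v. u \<in> uniform_roe_algebra \<Longrightarrow> v \<in> uniform_roe_algebra \<Longrightarrow>
      (\<lambda>n. tr (F n) (u o\<^sub>L ind A o\<^sub>L v) - tr (F n) (v o\<^sub>L ind A o\<^sub>L u)) \<longlonglongrightarrow> 0"
proof -
  have "\<exists>F. finite F \<and> F \<noteq> {} \<and> F \<subseteq> A \<and> card (nbhd A n F) \<le> (1 + 1 / Suc n) * card F" for n :: nat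
    using folner_set[OF bg A, of "real n" "1 / Suc n"] by (metis of_nat_0_le_iff of_nat_0_less_iff zero_less_Suc zero_less_divide_1_iff)
  then obtain F where F: "\<And>n. finite (F n)" "\<And>n. F n \<noteq> {}" "\<And>n. F n \<subseteq> A"
    "\<And>n. card (nbhd A n (F n)) \<le> (1 + 1 / Suc n) * card (F n)"
    by metis
  define comm where "comm u v = (u o\<^sub>L ind A o\<^sub>L v) - (v o\<^sub>L ind A o\<^sub>L u)" for u v :: "'a op2"
  have alg: "(\<lambda>n. tr (F n) (comm u v)) \<longlonglongrightarrow> 0"
    if u: "clin u" "has_prop R1 u" and v: "clin v" "has_prop R2 v" for u v R1 R2
  proof -
    define R where "R = max 0 (max R1 R2)"
    have uR: "has_prop R u" and vR: "has_prop R v" and R: "0 \<le> R"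
      using has_prop_mono[OF u(2), of R] has_prop_mono[OF v(2), of R] by (auto simp: R_def)
    obtain N :: nat where N: "\<And>x::'a. finite (cball x R)" "\<And>x::'a. card (cball x R) \<le> N"
      using bounded_geometryE[OF bg] by metis
    define K where "K = 2 * (N * (norm u * norm v))"
    have "cmod (tr (F n) (comm u v)) \<le> K * (1 / Suc n)" if n: "R \<le> real n" for n
    proof -
      have c: "0 < card (F n)"
        using F(1,2) by (simp add: card_gt_0_iff)
      have "card (nbhd A R (F n) - F n) = real (card (nbhd A R (F n))) - card (F n)"
      proof -
        have sub: "F n \<subseteq> nbhd A R (F n)"
          using F(3) R by (force simp: nbhd_def)
        then show ?thesis
          using card_mono[OF finite_nbhd[OF bg F(1)] sub] F(1)
          by (simp add: card_Diff_subset of_nat_diff)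
      qed
      also have "\<dots> \<le> real (card (nbhd A n (F n))) - card (F n)"
      proof -
        have "nbhd A R (F n) \<subseteq> nbhd A n (F n)"
          using n by (force simp: nbhd_def)
        then show ?thesis
          using card_mono[OF finite_nbhd[OF bg F(1)]] by simp
      qed
      also have "\<dots> \<le> (1 / Suc n) * card (F n)"
        using F(4)[of n] by (simp add: algebra_simps)
      finally have D: "card (nbhd A R (F n) - F n) \<le> (1 / Suc n) * card (F n)" .
      have "cmod (tr (F n) (comm u v)) * card (F n) \<le>
          2 * (card (nbhd A R (F n) - F n) * (N * (norm u * norm v)))"
        using tr_commutator_le[OF u(1) uR v(1) vR N F(1,3) R] unfolding comm_def tr_diff .
      also have "\<dots> = card (nbhd A R (F n) - F n) * K"
        by (simp add: K_def)
      also have "\<dots> \<le> (1 / Suc n) * card (F n) * K"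
        by (intro mult_right_mono D) (simp add: K_def)
      finally have "cmod (tr (F n) (comm u v)) * card (F n) \<le> (K * (1 / Suc n)) * card (F n)"
        by (simp add: mult_ac)
      then show ?thesis
        by (rule mult_right_le_imp_le) (simp add: c)
    qed
    then have "\<forall>\<^sub>F n in sequentially. norm (tr (F n) (comm u v)) \<le> K * (1 / Suc n)"
      by (meson eventually_sequentiallyI nat_ceiling_le_eq)
    moreover have "(\<lambda>n. K * (1 / Suc n)) \<longlonglongrightarrow> K * 0"
      by (intro tendsto_intros lim_1_over_n[THEN LIMSEQ_Suc])
    ultimately show ?thesis
      by (auto intro: Lim_null_comparison)
  qed
  have "(\<lambda>n. tr (F n) (comm u v)) \<longlonglongrightarrow> 0"
    if uv: "u \<in> uniform_roe_algebra" "v \<in> uniform_roe_algebra" for u v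
  proof (rule tendstoI)
    fix e :: real assume e: "0 < e"
    obtain s R where s: "\<And>n. clin (s n)" "\<And>n. has_prop (R n) (s n)" "s \<longlonglongrightarrow> u"
      by (rule uniform_roe_algebraE[OF bg uv(1)]) (rule that)
    obtain t R' where t: "\<And>n. clin (t n)" "\<And>n. has_prop (R' n) (t n)" "t \<longlonglongrightarrow> v"
      by (rule uniform_roe_algebraE[OF bg uv(2)]) (rule that)
    note lim = bounded_bilinear.tendsto[OF bounded_bilinear_blinfun_compose]
    have "(\<lambda>k. comm (s k) (t k)) \<longlonglongrightarrow> comm u v"
      unfolding comm_def by (intro tendsto_diff lim s t tendsto_const)
    then have "\<forall>\<^sub>F k in sequentially. dist (comm (s k) (t k)) (comm u v) < e / 2"
      using e by (intro tendstoD) auto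
    then obtain k where k: "norm (comm u v - comm (s k) (t k)) < e / 2"
      by (auto simp: eventually_sequentially dist_norm norm_minus_commute)
    have "\<forall>\<^sub>F n in sequentially. dist (tr (F n) (comm (s k) (t k))) 0 < e / 2"
      using e by (intro tendstoD alg[OF s(1,2) t(1,2)]) auto
    then show "\<forall>\<^sub>F n in sequentially. dist (tr (F n) (comm u v)) 0 < e"
    proof eventually_elim
      case (elim n)
      have "tr (F n) (comm u v) = tr (F n) (comm u v - comm (s k) (t k)) + tr (F n) (comm (s k) (t k))"
        by (simp add: tr_diff)
      also have "cmod \<dots> \<le> norm (comm u v - comm (s k) (t k)) + cmod (tr (F n) (comm (s k) (t k)))"
        by (intro order_trans[OF norm_triangle_ineq] add_right_mono cmod_tr_le)
      also have "\<dots> < e"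
        using k elim by simp
      finally show ?case by simp
    qed
  qed
  then show ?thesis
    using that[of F] F(1-3) unfolding comm_def tr_diff by blast
qed

subsection \<open>Schur multipliers\<close>

lemma gram_kernel_le_1:
  fixes \<eta> :: "'a \<Rightarrow> 'b \<Rightarrow> real"
  assumes "\<And>x Z. finite Z \<Longrightarrow> (\<Sum>z\<in>Z. (\<eta> x z)\<^sup>2) \<le> 1"
  shows "\<bar>\<Sum>z\<in>Z. \<eta> x z * \<eta> y z\<bar> \<le> 1"
proof (cases "finite Z")
  case True
  have "\<bar>\<Sum>z\<in>Z. \<eta> x z * \<eta> y z\<bar> \<le> (\<Sum>z\<in>Z. \<bar>\<eta> x z\<bar> * \<bar>\<eta> y z\<bar>)"
    unfolding abs_mult[symmetric] by (rule sum_abs)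
  also have "\<dots> \<le> L2_set (\<eta> x) Z * L2_set (\<eta> y) Z"
    by (rule L2_set_mult_ineq)
  also have "\<dots> \<le> 1 * 1"
    using assms[OF True] by (intro mult_mono) (auto simp: L2_set_def sum_nonneg)
  finally show ?thesis by simp
qed simp

text \<open>The Schur multiplier of the Gram kernel of the vectors \<open>\<eta> x\<close> is
  \<open>T \<mapsto> \<Sum>z. D\<^sub>z T D\<^sub>z\<close> with \<open>D\<^sub>z\<close> the diagonal operator of \<open>x \<mapsto> \<eta> x z\<close>, hence a contraction.\<close>

lemma schur_multiplier:
  fixes T :: "'a::metric_space op2" and \<eta> :: "'a \<Rightarrow> 'a \<Rightarrow> real"
  assumes bg: "bounded_geometry TYPE('a)" and T: "clin T"
    and supp: "\<And>x z. s < dist x z \<Longrightarrow> \<eta> x z = 0"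
    and le1: "\<And>x Z. finite Z \<Longrightarrow> (\<Sum>z\<in>Z. (\<eta> x z)\<^sup>2) \<le> 1"
  obtains M :: "'a op2" where "clin M" "has_prop (2 * s) M" "norm M \<le> norm T"
    "\<And>x y. coord (M (ket y)) x = of_real (\<Sum>z\<in>cball x s. \<eta> x z * \<eta> y z) * coord (T (ket y)) x"
proof -
  have fin: "finite (cball x R)" for x :: 'a and R
    using bg by (auto elim: bounded_geometryE)
  define k where "k x y = (\<Sum>z\<in>cball x s. \<eta> x z * \<eta> y z)" for x y
  \<comment> \<open>The summation range of the kernel can be enlarged, so that one finite
    \<open>Z\<close> later serves all rows in \<open>F\<close>.\<close>
  have k_eq: "k x y = (\<Sum>z\<in>Z. \<eta> x z * \<eta> y z)" if "finite Z" "cball x s \<subseteq> Z" for x y Z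
    unfolding k_def using that supp by (intro sum.mono_neutral_left) (auto simp: not_le)
  have k1: "\<bar>k x y\<bar> \<le> 1" for x y
    unfolding k_def by (rule gram_kernel_le_1) (rule le1)
  have k0: "k x y = 0" if "2 * s < dist x y" for x y
    unfolding k_def
  proof (intro sum.neutral ballI)
    fix z assume "z \<in> cball x s"
    then have "s < dist y z"
      using that dist_triangle[of x y z] by (simp add: dist_commute)
    then show "\<eta> x z * \<eta> y z = 0"
      by (simp add: supp)
  qed
  obtain N :: nat where N: "\<And>x::'a. card (cball x (2 * s)) \<le> N"
    using bounded_geometryE[OF bg] by metis
  have ent: "cmod (of_real (k x y) * coord (T (ket y)) x) \<le> norm T" for x y
    using mult_mono[OF k1[of x y] cmod_entry_le[of T y x]] by (simp add: norm_mult)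
  \<comment> \<open>The kernel vanishes beyond \<open>2 * s\<close>, so the product matrix has
    finite propagation whatever that of \<open>T\<close>. The Schur test would bound
    \<open>M\<close> only by \<open>norm T * N\<close>; contractivity is shown below.\<close>
  obtain M :: "'a op2" where M: "clin M" "has_prop (2 * s) M"
    "\<And>x y. coord (M (ket y)) x = of_real (k x y) * coord (T (ket y)) x"
    by (rule matrix_operator[of "2 * s" N "\<lambda>x y. of_real (k x y) * coord (T (ket y)) x", OF fin N ent])
      (use k0 that in auto)
  have "norm (M f) \<le> norm T * norm f" for f
  proof (rule norm_ell2_leI)
    fix F :: "'a set" assume F: "finite F"
    let ?n = "L2_set (\<lambda>x. cmod (coord (M f) x)) F"
    define G where "G = (\<Union>x\<in>F. cball x (2 * s))"
    define Z where "Z = (\<Union>x\<in>F. cball x s)"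
    have G: "finite G" and Z: "finite Z"
      using F fin by (auto simp: G_def Z_def)
    \<comment> \<open>\<open>u z\<close> and \<open>v z\<close> are \<open>D_z\<close> applied to
      the truncations of \<open>M f\<close> to \<open>F\<close> and of \<open>f\<close> to
      \<open>G\<close>; \<open>G\<close> contains every column that a row in \<open>F\<close> can
      reach.\<close>
    define u where "u z = (\<Sum>x\<in>F. scale (of_real (\<eta> x z) * coord (M f) x) (ket x))" for z
    define v where "v z = (\<Sum>y\<in>G. scale (of_real (\<eta> y z) * coord f y) (ket y))" for z
    \<comment> \<open>Summing over \<open>z\<close> first leaves each \<open>(cmod (c x))^2\<close>
      with a weight of at most 1, by \<open>le1\<close>.\<close>
    have gram: "L2_set (\<lambda>z. norm (\<Sum>x\<in>E. scale (of_real (\<eta> x z) * c x) (ket x))) Z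
        \<le> L2_set (\<lambda>x. cmod (c x)) E" if E: "finite E" for E and c :: "'a \<Rightarrow> complex"
    proof -
      have "(\<Sum>z\<in>Z. (norm (\<Sum>x\<in>E. scale (of_real (\<eta> x z) * c x) (ket x)))\<^sup>2) =
          (\<Sum>z\<in>Z. \<Sum>x\<in>E. (cmod (c x))\<^sup>2 * (\<eta> x z)\<^sup>2)"
        unfolding norm_sum_ket[OF E] by (simp add: L2_set_def sum_nonneg norm_mult power_mult_distrib mult.commute)
      also have "\<dots> = (\<Sum>x\<in>E. (cmod (c x))\<^sup>2 * (\<Sum>z\<in>Z. (\<eta> x z)\<^sup>2))"
        by (subst sum.swap) (simp add: sum_distrib_left)
      also have "\<dots> \<le> (\<Sum>x\<in>E. (cmod (c x))\<^sup>2 * 1)"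
        by (intro sum_mono mult_left_mono le1 Z) auto
      finally show ?thesis
        by (simp add: L2_set_def)
    qed
    have row: "coord (M f) x = (\<Sum>y\<in>G. of_real (k x y) * coord (T (ket y)) x * coord f y)" if "x \<in> F" for x
    proof -
      have "coord (M f) x = (\<Sum>y\<in>cball x (2 * s). of_real (k x y) * coord (T (ket y)) x * coord f y)"
        using coord_eq_sum_entries[OF M(1,2) fin, of f x] by (simp add: M(3))
      also have "\<dots> = (\<Sum>y\<in>G. of_real (k x y) * coord (T (ket y)) x * coord f y)"
        using that k0 by (intro sum.mono_neutral_left G) (auto simp: G_def)
      finally show ?thesis .
    qed
    have form: "cinner (u z) (T (v z)) = (\<Sum>x\<in>F. \<Sum>y\<in>G.
        cnj (coord (M f) x) * (of_real (\<eta> x z * \<eta> y z) * coord (T (ket y)) x * coord f y))" for z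
    proof -
      have "cinner (u z) (T (v z)) = cnj (cinner (T (v z)) (u z))"
        by (rule cinner_commute)
      also have "cinner (T (v z)) (u z) = (\<Sum>x\<in>F. of_real (\<eta> x z) * coord (M f) x * cnj (coord (T (v z)) x))"
        unfolding u_def by (simp add: cinner_sum_right cinner_scale_right cinner_commute[of "T (v z)" "ket _"])
      also have "cnj \<dots> = (\<Sum>x\<in>F. of_real (\<eta> x z) * cnj (coord (M f) x) * coord (T (v z)) x)"
        by simp
      finally have "cinner (u z) (T (v z)) =
          (\<Sum>x\<in>F. of_real (\<eta> x z) * cnj (coord (M f) x) * coord (T (v z)) x)" .
      moreover have "coord (T (v z)) x = (\<Sum>y\<in>G. of_real (\<eta> y z) * coord f y * coord (T (ket y)) x)" for x
        using T by (simp add: v_def blinfun.sum_right clin_def)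
      ultimately show ?thesis
        by (simp add: sum_distrib_left mult_ac)
    qed
    have "of_real (?n\<^sup>2) = (\<Sum>x\<in>F. of_real ((cmod (coord (M f) x))\<^sup>2))"
      by (simp add: L2_set_def sum_nonneg)
    also have "\<dots> = (\<Sum>x\<in>F. cnj (coord (M f) x) * coord (M f) x)"
      by (simp only: complex_norm_square mult.commute)
    also have "\<dots> = (\<Sum>x\<in>F. \<Sum>y\<in>G. \<Sum>z\<in>Z.
        cnj (coord (M f) x) * (of_real (\<eta> x z * \<eta> y z) * coord (T (ket y)) x * coord f y))"
    proof (intro sum.cong refl)
      fix x assume x: "x \<in> F"
      have "k x y = (\<Sum>z\<in>Z. \<eta> x z * \<eta> y z)" for y
        using x by (intro k_eq Z) (auto simp: Z_def)
      then show "cnj (coord (M f) x) * coord (M f) x = (\<Sum>y\<in>G. \<Sum>z\<in>Z.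
          cnj (coord (M f) x) * (of_real (\<eta> x z * \<eta> y z) * coord (T (ket y)) x * coord f y))"
        by (subst (2) row[OF x]) (simp add: sum_distrib_left sum_distrib_right)
    qed
    also have "\<dots> = (\<Sum>x\<in>F. \<Sum>z\<in>Z. \<Sum>y\<in>G.
        cnj (coord (M f) x) * (of_real (\<eta> x z * \<eta> y z) * coord (T (ket y)) x * coord f y))"
      by (intro sum.cong refl sum.swap)
    also have "\<dots> = (\<Sum>z\<in>Z. cinner (u z) (T (v z)))"
      unfolding form by (rule sum.swap)
    finally have "?n\<^sup>2 = cmod (\<Sum>z\<in>Z. cinner (u z) (T (v z)))"
      by (metis norm_of_real abs_power2)
    also have "\<dots> \<le> (\<Sum>z\<in>Z. norm (u z) * (norm T * norm (v z)))"
      by (intro sum_norm_le order_trans[OF cinner_cauchy_schwarz] mult_left_mono norm_blinfun) auto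
    also have "\<dots> = norm T * (\<Sum>z\<in>Z. \<bar>norm (u z)\<bar> * \<bar>norm (v z)\<bar>)"
      by (simp add: sum_distrib_left mult_ac)
    also have "\<dots> \<le> norm T * (L2_set (\<lambda>z. norm (u z)) Z * L2_set (\<lambda>z. norm (v z)) Z)"
      by (intro mult_left_mono L2_set_mult_ineq) auto
    also have "\<dots> \<le> norm T * (?n * norm f)"
      unfolding u_def v_def
      by (intro mult_left_mono mult_mono gram F order_trans[OF gram L2_set_le_norm_ell2] G)
        (auto simp: L2_set_nonneg)
    finally have "?n * ?n \<le> (norm T * norm f) * ?n"
      by (simp add: power2_eq_square mult_ac)
    then show "?n \<le> norm T * norm f"
      using L2_set_nonneg[of "\<lambda>x. cmod (coord (M f) x)" F]
      by (metis mult_le_cancel_right norm_ge_zero not_less order_le_less zero_le_mult_iff)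
  qed auto
  then have "norm M \<le> norm T"
    by (intro norm_blinfun_bound) auto
  then show ?thesis
    using that[of M] M unfolding k_def by blast
qed

text \<open>Square roots turn the \<open>l^1\<close> vectors of property A into unit vectors of
  \<open>l^2\<close>. Twice the defect of the kernel is their squared distance, and
  \<open>(a - b)^2 \<le> |a^2 - b^2|\<close> for non-negative \<open>a\<close> and \<open>b\<close>
  bounds it by the \<open>l^1\<close> distance.\<close>

lemma property_A_kernel:
  assumes bg: "bounded_geometry TYPE('a::metric_space)" and pA: "property_A TYPE('a)" and e: "0 < (e :: real)"
  obtains s and \<eta> :: "'a::metric_space \<Rightarrow> 'a \<Rightarrow> real" where "\<And>x z. s < dist x z \<Longrightarrow> \<eta> x z = 0"
    "\<And>x Z. finite Z \<Longrightarrow> (\<Sum>z\<in>Z. (\<eta> x z)\<^sup>2) \<le> 1"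
    "\<And>x y. dist x y \<le> R \<Longrightarrow> \<bar>1 - (\<Sum>z\<in>cball x s. \<eta> x z * \<eta> y z)\<bar> \<le> e"
proof -
  have fin: "finite (cball x R)" for x :: 'a and R
    using bg by (auto elim: bounded_geometryE)
  have "0 < max R 1"
    by simp
  then obtain s and \<xi> :: "'a \<Rightarrow> 'a \<Rightarrow> real" where
    \<xi>1: "\<forall>x. (\<forall>z. 0 \<le> \<xi> x z) \<and> (\<xi> x has_sum 1) UNIV \<and> (\<forall>z. \<xi> x z \<noteq> 0 \<longrightarrow> z \<in> cball x s)"
    and \<xi>2: "\<forall>x y. dist x y \<le> max R 1 \<longrightarrow> (\<Sum>\<^sub>\<infinity>z. \<bar>\<xi> x z - \<xi> y z\<bar>) < e"
    using pA[unfolded property_A_def, rule_format, of "max R 1", OF \<open>0 < max R 1\<close> e] by (elim exE conjE) (rule that)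
  have \<xi>: "0 \<le> \<xi> x z" "(\<xi> x has_sum 1) UNIV" "\<xi> x z \<noteq> 0 \<Longrightarrow> z \<in> cball x s"
    "dist x y \<le> max R 1 \<Longrightarrow> (\<Sum>\<^sub>\<infinity>z. \<bar>\<xi> x z - \<xi> y z\<bar>) < e" for x y z
    using \<xi>1[THEN spec, of x] \<xi>2[THEN spec, THEN spec, of x y] by simp_all
  define \<eta> where "\<eta> x z = sqrt (\<xi> x z)" for x z
  have sum1: "(\<Sum>z\<in>Z. \<xi> x z) = 1" if "finite Z" "cball x s \<subseteq> Z" for x Z
  proof -
    have "(\<xi> x has_sum 1) Z"
      using \<xi>(2)[of x]
    proof (rule has_sum_cong_neutral[THEN iffD1, rotated -1])
      show "\<xi> x z = 0" if "z \<in> UNIV - Z" for z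
        using that \<xi>(3)[of x z] \<open>cball x s \<subseteq> Z\<close> by blast
    qed auto
    then show ?thesis
      using that(1) by (simp add: has_sum_finite_iff)
  qed
  show ?thesis
  proof (rule that[of s \<eta>])
    show "\<eta> x z = 0" if "s < dist x z" for x z
      using \<xi>(3)[of x z] that by (auto simp: \<eta>_def)
    show "(\<Sum>z\<in>Z. (\<eta> x z)\<^sup>2) \<le> 1" if "finite Z" for x Z
    proof -
      have "(\<Sum>z\<in>Z. (\<eta> x z)\<^sup>2) = (\<Sum>z\<in>Z. \<xi> x z)"
        by (simp add: \<eta>_def \<xi>(1))
      also have "\<dots> \<le> (\<Sum>z\<in>Z \<union> cball x s. \<xi> x z)"
        using that fin \<xi>(1) by (intro sum_mono2) auto
      also have "\<dots> = 1"
        using that fin by (intro sum1) auto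
      finally show ?thesis .
    qed
    show "\<bar>1 - (\<Sum>z\<in>cball x s. \<eta> x z * \<eta> y z)\<bar> \<le> e" if xy: "dist x y \<le> R" for x y
    proof -
      define Z where "Z = cball x s \<union> cball y s"
      have Z: "finite Z"
        by (simp add: Z_def fin)
      have "(\<Sum>z\<in>cball x s. \<eta> x z * \<eta> y z) = (\<Sum>z\<in>Z. \<eta> x z * \<eta> y z)"
      proof (intro sum.mono_neutral_left Z ballI)
        show "\<eta> x z * \<eta> y z = 0" if "z \<in> Z - cball x s" for z
          using that \<xi>(3)[of x z] by (auto simp: \<eta>_def)
      qed (simp add: Z_def)
      then have "2 * (1 - (\<Sum>z\<in>cball x s. \<eta> x z * \<eta> y z)) = 
          (\<Sum>z\<in>Z. \<xi> x z) + (\<Sum>z\<in>Z. \<xi> y z) - 2 * (\<Sum>z\<in>Z. \<eta> x z * \<eta> y z)"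
        using Z by (simp add: sum1 Z_def)
      also have "\<dots> = (\<Sum>z\<in>Z. (\<eta> x z - \<eta> y z)\<^sup>2)"
        by (simp add: \<eta>_def \<xi>(1) power2_diff sum.distrib sum_subtractf sum_distrib_left mult.assoc)
      finally have eq: "2 * (1 - (\<Sum>z\<in>cball x s. \<eta> x z * \<eta> y z)) = (\<Sum>z\<in>Z. (\<eta> x z - \<eta> y z)\<^sup>2)" .
      have "(\<Sum>z\<in>Z. (\<eta> x z - \<eta> y z)\<^sup>2) \<le> (\<Sum>z\<in>Z. \<bar>\<xi> x z - \<xi> y z\<bar>)"
      proof (rule sum_mono)
        fix z
        have "(\<eta> x z - \<eta> y z)\<^sup>2 = \<bar>\<eta> x z - \<eta> y z\<bar> * \<bar>\<eta> x z - \<eta> y z\<bar>"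
          by (simp add: power2_eq_square)
        also have "\<dots> \<le> \<bar>\<eta> x z - \<eta> y z\<bar> * \<bar>\<eta> x z + \<eta> y z\<bar>"
        proof (rule mult_left_mono)
          have "0 \<le> \<eta> x z" "0 \<le> \<eta> y z"
            by (simp_all add: \<eta>_def \<xi>(1))
          then show "\<bar>\<eta> x z - \<eta> y z\<bar> \<le> \<bar>\<eta> x z + \<eta> y z\<bar>"
            by linarith
        qed simp
        also have "\<dots> = \<bar>(\<eta> x z)\<^sup>2 - (\<eta> y z)\<^sup>2\<bar>"
          by (simp add: abs_mult[symmetric] power2_eq_square algebra_simps)
        finally show "(\<eta> x z - \<eta> y z)\<^sup>2 \<le> \<bar>\<xi> x z - \<xi> y z\<bar>"
          by (simp add: \<eta>_def \<xi>(1))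
      qed
      also have "\<dots> = (\<Sum>\<^sub>\<infinity>z\<in>Z. \<bar>\<xi> x z - \<xi> y z\<bar>)"
        using Z by simp
      also have "\<dots> = (\<Sum>\<^sub>\<infinity>z. \<bar>\<xi> x z - \<xi> y z\<bar>)"
      proof (rule infsum_cong_neutral)
        show "\<bar>\<xi> x z - \<xi> y z\<bar> = 0" if "z \<in> UNIV - Z" for z
        proof -
          have "\<xi> x z = 0" "\<xi> y z = 0"
            using that \<xi>(3)[of x z] \<xi>(3)[of y z] by (auto simp: Z_def)
          then show ?thesis by simp
        qed
      qed auto
      also have "\<dots> < e"
        using xy by (intro \<xi>(4)) auto
      finally have "2 * (1 - (\<Sum>z\<in>cball x s. \<eta> x z * \<eta> y z)) < e"
        unfolding eq .
      moreover have "0 \<le> 2 * (1 - (\<Sum>z\<in>cball x s. \<eta> x z * \<eta> y z))"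
        unfolding eq by (intro sum_nonneg) auto
      ultimately show ?thesis
        by (simp add: abs_le_iff)
    qed
  qed
qed

text \<open>This is where property A enters: an operator of the uniform Roe algebra is close to a finite
  propagation operator whose columns are dominated entrywise by its own.\<close>

lemma small_columns_negligible:
  fixes T :: "'a::metric_space op2"
  assumes bg: "bounded_geometry TYPE('a)" and pA: "property_A TYPE('a)"
    and T: "T \<in> uniform_roe_algebra" and e: "0 < e"
  obtains \<delta> where "0 < \<delta>" "norm (T o\<^sub>L ind {x. norm (T (ket x)) < \<delta>}) \<le> e"
proof -
  have fin: "finite (cball x r)" for x :: 'a and r
    using bg by (auto elim: bounded_geometryE)
  have cT: "clin T"
    by (rule clin_uniform_roe_algebra[OF bg T])
  obtain S R where S: "\<And>n. clin (S n)" "\<And>n. has_prop (R n) (S n)" "S \<longlonglongrightarrow> T"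
    by (rule uniform_roe_algebraE[OF bg T]) (rule that)
  \<comment> \<open>Four errors are each kept at \<open>e / 8\<close>: \<open>T - a\<close>,
    \<open>a - M\<close>, \<open>D\<close>, and finally \<open>L\<close> on the small
    columns.\<close>
  have "\<forall>\<^sub>F n in sequentially. dist (S n) T < e / 8"
    using e by (intro tendstoD[OF S(3)]) auto
  then obtain n where n: "norm (T - S n) < e / 8"
    by (auto simp: eventually_sequentially dist_norm norm_minus_commute)
  define a where "a = S n"
  have a: "clin a" "has_prop (R n) a" "norm (T - a) < e / 8"
    using S n by (auto simp: a_def)
  obtain N :: nat where N: "\<And>x::'a. finite (cball x (R n))" "\<And>x::'a. card (cball x (R n)) \<le> N"
    using bounded_geometryE[OF bg] by metis
  \<comment> \<open>With kernel tolerance \<open>c = e / (8 * K)\<close> the Schur test bounds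
    \<open>a - M\<close> by \<open>c * norm a * N\<close>, hence by \<open>e / 8\<close>.\<close>
  define K where "K = (norm a + 1) * (N + 1)"
  have K: "0 < K"
    unfolding K_def by (intro mult_pos_pos add_nonneg_pos) auto
  define c where "c = e / (8 * K)"
  have c: "0 < c"
    unfolding c_def using e K by simp
  obtain s and \<eta> :: "'a \<Rightarrow> 'a \<Rightarrow> real" where \<eta>: "\<And>x z. s < dist x z \<Longrightarrow> \<eta> x z = 0"
    "\<And>x Z. finite Z \<Longrightarrow> (\<Sum>z\<in>Z. (\<eta> x z)\<^sup>2) \<le> 1"
    "\<And>x y. dist x y \<le> R n \<Longrightarrow> \<bar>1 - (\<Sum>z\<in>cball x s. \<eta> x z * \<eta> y z)\<bar> \<le> c"
    by (rule property_A_kernel[OF bg pA c, of "R n"]) (rule that)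
  define k where "k x y = (\<Sum>z\<in>cball x s. \<eta> x z * \<eta> y z)" for x y
  \<comment> \<open>Multiplying \<open>a\<close> and \<open>T - a\<close> separately and adding
    gives the multiplier of \<open>T\<close> with both parts under control: the first stays close to
    \<open>a\<close>, the second stays small.\<close>
  obtain M where M: "clin M" "has_prop (2 * s) M"
    "\<And>x y. coord (M (ket y)) x = of_real (k x y) * coord (a (ket y)) x"
    unfolding k_def by (rule schur_multiplier[OF bg a(1), of s \<eta>]) (use \<eta>(1,2) that in auto)
  obtain D where D: "clin D" "has_prop (2 * s) D" "norm D \<le> norm (T - a)"
    "\<And>x y. coord (D (ket y)) x = of_real (k x y) * coord ((T - a) (ket y)) x"
    unfolding k_def by (rule schur_multiplier[OF bg clin_diff[OF cT a(1)], of s \<eta>])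
      (use \<eta>(1,2) that in auto)
  define L where "L = M + D"
  have L: "clin L" "has_prop (2 * s) L"
    "\<And>x y. coord (L (ket y)) x = of_real (k x y) * coord (T (ket y)) x"
    using M D by (auto simp: L_def has_prop_def blinfun.add_left blinfun.diff_left algebra_simps)
  have "norm (a - M) \<le> (c * norm a) * N"
  proof (rule norm_has_prop_le[OF _ _ N])
    show "clin (a - M)"
      using a(1) M(1) by simp
    show entry: "cmod (coord ((a - M) (ket y)) x) \<le> c * norm a" for x y
    proof (cases "dist x y \<le> R n")
      case True
      have "coord ((a - M) (ket y)) x = of_real (1 - k x y) * coord (a (ket y)) x"
        by (simp add: blinfun.diff_left M(3) algebra_simps)
      then have "cmod (coord ((a - M) (ket y)) x) = \<bar>1 - k x y\<bar> * cmod (coord (a (ket y)) x)"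
        by (simp add: norm_mult del: of_real_diff)
      also have "\<dots> \<le> c * norm a"
        unfolding k_def using c by (intro mult_mono \<eta>(3) True cmod_entry_le) auto
      finally show ?thesis .
    next
      case False
      then have "coord ((a - M) (ket y)) x = 0"
        using has_prop_entry[OF a(2), of x y] by (simp add: blinfun.diff_left M(3))
      then show ?thesis
        using c by simp
    qed
    show "has_prop (R n) (a - M)"
      unfolding has_prop_def
    proof (intro allI impI)
      fix f :: "'a ell2" and x assume f: "\<forall>y. dist x y \<le> R n \<longrightarrow> coord f y = 0"
      have "coord (M (ket y)) x * coord f y = 0" for y
        using f has_prop_entry[OF a(2), of x y] by (cases "dist x y \<le> R n") (auto simp: M(3))
      then have "coord (M f) x = 0"
        using coord_eq_sum_entries[OF M(1,2) fin, of f x] by (simp only: sum.neutral_const)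
      moreover have "coord (a f) x = 0"
        using a(2) f by (simp add: has_prop_def)
      ultimately show "coord ((a - M) f) x = 0"
        by (simp add: blinfun.diff_left)
    qed
  qed
  also have "\<dots> = (c * (norm a * N))"
    by simp
  also have "\<dots> \<le> c * K"
    unfolding K_def using c by (intro mult_left_mono mult_mono) auto
  also have "\<dots> = e / 8"
    using K by (simp add: c_def)
  finally have aM: "norm (a - M) \<le> e / 8" .
  have TL: "norm (T - L) \<le> 3 * e / 8"
  proof -
    have "T - L = (T - a) + (a - M) - D"
      by (simp add: L_def)
    also have "norm \<dots> \<le> norm (T - a) + norm (a - M) + norm D"
      by (intro order_trans[OF norm_triangle_ineq4] add_right_mono norm_triangle_ineq)
    also have "\<dots> \<le> 3 * e / 8"
      using a(3) aM D(3) by simp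
    finally show ?thesis .
  qed
  obtain N' :: nat where N': "\<And>x::'a. finite (cball x (2 * s))" "\<And>x::'a. card (cball x (2 * s)) \<le> N'"
    using bounded_geometryE[OF bg] by metis
  \<comment> \<open>\<open>N'\<close> bounds balls of radius \<open>2 * s\<close>, so it is fixed
    before \<open>\<delta>\<close>. Entries of \<open>L\<close> in small columns are at most
    \<open>\<delta>\<close>, and the Schur test costs the factor \<open>N'\<close>.\<close>
  define \<delta> where "\<delta> = e / (8 * (N' + 1))"
  have \<delta>: "0 < \<delta>"
    using e by (simp add: \<delta>_def)
  define B where "B = {x. norm (T (ket x)) < \<delta>}"
  have k1: "\<bar>k x y\<bar> \<le> 1" for x y
    unfolding k_def by (rule gram_kernel_le_1) (rule \<eta>(2))
  have "norm (L o\<^sub>L ind B) \<le> \<delta> * N'"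
  proof (rule norm_has_prop_le[OF _ _ N'])
    show "clin (L o\<^sub>L ind B)"
      using L(1) by simp
    show "has_prop (2 * s) (L o\<^sub>L ind B)"
      using L(2) by (simp add: has_prop_def)
    show "cmod (coord ((L o\<^sub>L ind B) (ket y)) x) \<le> \<delta>" for x y
    proof (cases "y \<in> B")
      case True
      have "cmod (coord ((L o\<^sub>L ind B) (ket y)) x) = \<bar>k x y\<bar> * cmod (coord (T (ket y)) x)"
        using True by (simp add: ind_ket L(3) norm_mult)
      also have "\<dots> \<le> 1 * \<delta>"
        using k1 True cmod_coord_le[of "T (ket y)" x] by (intro mult_mono) (auto simp: B_def)
      finally show ?thesis by simp
    qed (use \<delta> in \<open>simp add: ind_ket\<close>)
  qed
  also have "\<dots> \<le> \<delta> * (N' + 1)"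
    using \<delta> by simp
  also have "\<dots> = e / 8"
    by (simp add: \<delta>_def field_simps)
  finally have LB: "norm (L o\<^sub>L ind B) \<le> e / 8" .
  have "T o\<^sub>L ind B = ((T - L) o\<^sub>L ind B) + (L o\<^sub>L ind B)"
    by (rule blinfun_eqI) (simp add: blinfun.add_left blinfun.diff_left)
  also have "norm \<dots> \<le> norm ((T - L) o\<^sub>L ind B) + norm (L o\<^sub>L ind B)"
    by (rule norm_triangle_ineq)
  also have "\<dots> \<le> norm (T - L) * 1 + norm (L o\<^sub>L ind B)"
    by (intro add_right_mono order_trans[OF norm_blinfun_compose] mult_left_mono norm_ind_le) auto
  also have "\<dots> \<le> e"
    using TL LB e by simp
  finally show ?thesis
    using that[OF \<delta>] by (simp add: B_def)
qed

subsection \<open>Properly infinite projections\<close>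

lemma adj_ind [simp]: "adj (ind A) = ind A"
proof (rule adj_unique)
  show "cinner (ind A f) g = cinner f (ind A g)" for f g
    unfolding cinner_def by (rule infsum_cong) auto
qed

lemma projection_ind: "projection (ind A)"
  by (auto simp: projection_def intro!: blinfun_eqI ell2_eqI)

text \<open>The matrix sending \<open>ket y\<close> to \<open>ket (t y)\<close> for \<open>y\<close>
  in \<open>A\<close> and to 0 otherwise is a partial permutation; bounded displacement of
  \<open>t\<close> is its finite propagation.\<close>

lemma partial_translation_isometry:
  fixes t :: "'a::metric_space \<Rightarrow> 'a"
  assumes bg: "bounded_geometry TYPE('a)" and t: "partial_translation t A B"
  obtains v where "v \<in> uniform_roe_algebra" "adj v o\<^sub>L v = ind A" "v o\<^sub>L adj v = ind B"
proof -
  obtain R where R: "\<And>y. y \<in> A \<Longrightarrow> dist y (t y) \<le> R"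
    using t by (auto simp: partial_translation_def bdd_above_def)
  have bij: "bij_betw t A B"
    using t by (simp add: partial_translation_def)
  have fin: "finite (cball x R)" for x :: 'a
    using bg by (auto elim: bounded_geometryE)
  obtain N :: nat where N: "\<And>x::'a. card (cball x R) \<le> N"
    using bounded_geometryE[OF bg] by metis
  define a :: "'a \<Rightarrow> 'a \<Rightarrow> complex" where "a x y = (if y \<in> A \<and> x = t y then 1 else 0)" for x y
  have a1: "cmod (a x y) \<le> 1" for x y
    by (simp add: a_def)
  have a0: "a x y = 0" if "R < dist x y" for x y
    using R[of y] that by (auto simp: a_def dist_commute)
  obtain v :: "'a op2" where v: "clin v" "has_prop R v" "\<And>x y. coord (v (ket y)) x = a x y"
    by (rule matrix_operator[of R N a, OF fin N a1]) (use a0 that in auto)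
  have v_ket: "v (ket y) = (if y \<in> A then ket (t y) else 0)" for y
    by (rule ell2_eqI) (simp add: v(3) a_def)
  have adj_coord: "coord (adj v f) y = (if y \<in> A then coord f (t y) else 0)" for f y
    using cinner_adj_right[OF v(1), of "ket y" f] by (simp add: v_ket)
  have v_coord: "coord (v f) (t y) = coord f y" if "y \<in> A" for f y
  proof -
    have "y' \<in> A \<and> t y = t y' \<longleftrightarrow> y' = y" for y'
      using bij that by (auto simp: bij_betw_def inj_on_def)
    moreover have "y \<in> cball (t y) R"
      using R[OF that] by (simp add: dist_commute)
    ultimately show ?thesis
      using coord_eq_sum_entries[OF v(1,2) fin, of f "t y"] fin
      by (simp add: v(3) a_def if_distrib if_distribR sum.delta cong: if_cong)
  qed
  have v_zero: "coord (v f) x = 0" if "x \<notin> B" for f x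
  proof -
    have "a x y = 0" for y
      using that bij by (auto simp: a_def bij_betw_def)
    then show ?thesis
      using coord_eq_sum_entries[OF v(1,2) fin, of f x] by (simp add: v(3))
  qed
  show ?thesis
  proof
    show "v \<in> uniform_roe_algebra"
      by (rule uniform_roe_algebra_has_prop[OF bg v(1,2)])
    show "adj v o\<^sub>L v = ind A"
      by (intro blinfun_eqI ell2_eqI) (simp add: adj_coord v_coord)
    show "v o\<^sub>L adj v = ind B"
    proof (intro blinfun_eqI ell2_eqI)
      fix f x
      show "coord ((v o\<^sub>L adj v) f) x = coord (ind B f) x"
      proof (cases "x \<in> B")
        case True
        then obtain y where "y \<in> A" "x = t y"
          using bij by (auto simp: bij_betw_def)
        then show ?thesis
          using True by (simp add: v_coord adj_coord)
      qed (simp add: v_zero)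
    qed
  qed
qed

text \<open>The two range projections belong to the disjoint halves and add up to
  \<open>ind A\<close>, so the required inequality is an equality.\<close>

lemma properly_infinite_ind:
  fixes A :: "'a::metric_space set"
  assumes bg: "bounded_geometry TYPE('a)" and A: "paradoxical A"
  shows "properly_infinite_projection uniform_roe_algebra (ind A)"
proof -
  obtain A1 A2 t1 t2 where A12: "A = A1 \<union> A2" "A1 \<inter> A2 = {}"
    and t: "partial_translation t1 A A1" "partial_translation t2 A A2"
    using A unfolding paradoxical_def by blast
  obtain x where x: "x \<in> uniform_roe_algebra" "adj x o\<^sub>L x = ind A" "x o\<^sub>L adj x = ind A1"
    by (rule partial_translation_isometry[OF bg t(1)]) (rule that)
  obtain y where y: "y \<in> uniform_roe_algebra" "adj y o\<^sub>L y = ind A" "y o\<^sub>L adj y = ind A2"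
    by (rule partial_translation_isometry[OF bg t(2)]) (rule that)
  have pi: "partial_isometry v" if v: "v \<in> uniform_roe_algebra" "adj v o\<^sub>L v = ind A"
    "v o\<^sub>L adj v = ind C" for v :: "'a op2" and C
  proof -
    have cv: "clin v"
      by (rule clin_uniform_roe_algebra[OF bg v(1)])
    have vv: "adj v (v f) = ind A f" for f
      using v(2) by (metis blinfun_apply_blinfun_compose)
    \<comment> \<open>\<open>adj v o\<^sub>L v\<close> kills this difference, and \<open>v\<close>
      kills whatever that composition kills.\<close>
    have "v (f - ind A f) = 0" for f
    proof -
      let ?g = "f - ind A f"
      have "cinner (v ?g) (v ?g) = cinner (adj v (v ?g)) ?g"
        by (simp add: cinner_adj_left cv)
      also have "adj v (v ?g) = 0"
        by (rule ell2_eqI) (simp add: vv)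
      finally show ?thesis
        by (simp add: cinner_self)
    qed
    then have "v (ind A f) = v f" for f
      by (simp add: blinfun.diff_right)
    then show ?thesis
      unfolding partial_isometry_def by (intro blinfun_eqI) (simp add: vv)
  qed
  have "ind A1 + ind A2 = ind A"
    using A12 by (intro blinfun_eqI ell2_eqI) (auto simp: blinfun.add_left)
  then have "op_le ((x o\<^sub>L adj x) + (y o\<^sub>L adj y)) (ind A)"
    by (simp add: op_le_def positive_op_def x y)
  then show ?thesis
    unfolding properly_infinite_projection_def
    using uniform_roe_algebra_ind[OF bg] projection_ind x y pi by metis
qed

text \<open>Evaluated at \<open>f - p f\<close>, the identity \<open>norm (x f) = norm (p f)\<close>
  and the assumption \<open>le\<close> show that \<open>x\<close> and \<open>adj x\<close> vanish on
  the kernel of \<open>p\<close>. For \<open>adj x\<close> this dualises to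
  \<open>p (x f) = x f\<close>.\<close>

lemma isometry_below_projection:
  fixes p x :: "'a op2"
  assumes p: "clin p" "projection p" and x: "clin x" "adj x o\<^sub>L x = p"
    and le: "\<And>f. norm (adj x f) \<le> norm (p f)"
  shows "p (x f) = x f" "x (p f) = x f" "adj x (x f) = p f"
    "norm (x f) = norm (p f)" "norm x \<le> 1"
proof -
  have pp: "p (p f) = p f" for f
    by (rule projection_idem[OF p(2)])
  have psa: "cinner (p f) g = cinner f (p g)" for f g
    by (rule projection_cinner[OF p(1) p(2)])
  show xx: "adj x (x f) = p f" for f
    using x(2) by (metis blinfun_apply_blinfun_compose)
  show nx: "norm (x f) = norm (p f)" for f
  proof -
    have "cinner (x f) (x f) = cinner (p f) (p f)"
      by (simp add: xx pp psa flip: cinner_adj_right[OF x(1)])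
    then have "(norm (x f))\<^sup>2 = (norm (p f))\<^sup>2"
      unfolding cinner_self by (metis of_real_eq_iff)
    then show ?thesis
      by (simp add: power2_eq_iff_nonneg)
  qed
  show "x (p f) = x f" for f
    using nx[of "f - p f"] by (simp add: blinfun.diff_right pp)
  have ax: "adj x (p f) = adj x f" for f
    using le[of "f - p f"] by (simp add: blinfun.diff_right pp)
  show "p (x f) = x f" for f
  proof (rule ell2_cinner_eqI)
    fix g
    have "cinner (p (x f)) g = cinner f (adj x (p g))"
      by (simp add: psa cinner_adj_right[OF x(1)])
    then show "cinner (p (x f)) g = cinner (x f) g"
      by (simp add: ax cinner_adj_right[OF x(1)])
  qed
  show "norm x \<le> 1"
  proof (rule norm_blinfun_bound)
    fix f
    have "norm (x f) \<le> norm p * norm f"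
      unfolding nx by (rule norm_blinfun)
    also have "\<dots> \<le> 1 * norm f"
      by (intro mult_right_mono norm_projection_le p) auto
    finally show "norm (x f) \<le> 1 * norm f" .
  qed simp
qed

text \<open>Pairing the operator inequality with \<open>f\<close> gives
  \<open>(norm (adj x f))^2 + (norm (adj y f))^2 \<le> (norm (p f))^2\<close>. At \<open>x f\<close>
  the first summand already exhausts the right side, which makes the ranges of \<open>x\<close> and
  \<open>y\<close> orthogonal.\<close>

lemma properly_infiniteE:
  fixes p :: "'a::metric_space op2"
  assumes bg: "bounded_geometry TYPE('a)" and "properly_infinite_projection uniform_roe_algebra p"
  obtains x y where "p \<in> uniform_roe_algebra" "projection p"
    "x \<in> uniform_roe_algebra" "y \<in> uniform_roe_algebra" "norm x \<le> 1" "norm y \<le> 1"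
    "\<And>f. p (x f) = x f" "\<And>f. p (y f) = y f" "\<And>f. x (p f) = x f" "\<And>f. y (p f) = y f"
    "\<And>f. adj x (x f) = p f" "\<And>f. adj y (y f) = p f" "\<And>f. adj y (x f) = 0" "\<And>f. adj x (y f) = 0"
proof -
  obtain x y where p: "p \<in> uniform_roe_algebra" "projection p"
    and xy: "x \<in> uniform_roe_algebra" "y \<in> uniform_roe_algebra"
    and eq: "adj x o\<^sub>L x = p" "adj y o\<^sub>L y = p"
    and le: "op_le ((x o\<^sub>L adj x) + (y o\<^sub>L adj y)) p"
    using assms(2) unfolding properly_infinite_projection_def by blast
  note clin = clin_uniform_roe_algebra[OF bg p(1)] clin_uniform_roe_algebra[OF bg xy(1)]
    clin_uniform_roe_algebra[OF bg xy(2)]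
  have pp: "p (p f) = p f" for f
    by (rule projection_idem[OF p(2)])
  have psa: "cinner (p f) g = cinner f (p g)" for f g
    by (rule projection_cinner[OF clin(1) p(2)])
  have sq: "(norm (adj x f))\<^sup>2 + (norm (adj y f))\<^sup>2 \<le> (norm (p f))\<^sup>2" for f
  proof -
    have "cinner f (p f) = cinner (p f) (p f)"
      by (simp add: psa pp)
    moreover have "cinner f (x (adj x f)) = cinner (adj x f) (adj x f)"
      "cinner f (y (adj y f)) = cinner (adj y f) (adj y f)"
      by (simp_all add: cinner_adj_left clin)
    moreover have "0 \<le> Re (cinner f ((p - ((x o\<^sub>L adj x) + (y o\<^sub>L adj y))) f))"
      using le by (simp add: op_le_def positive_op_def)
    ultimately show ?thesis
      by (simp add: blinfun.diff_left blinfun.add_left cinner_diff_right cinner_add_right cinner_self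
          del: of_real_power)
  qed
  have ax: "norm (adj x f) \<le> norm (p f)" and ay: "norm (adj y f) \<le> norm (p f)" for f
    using sq[of f] by (smt (verit) power2_le_imp_le norm_ge_zero zero_le_power2)+
  note x = isometry_below_projection[OF clin(1) p(2) clin(2) eq(1) ax]
  note y = isometry_below_projection[OF clin(1) p(2) clin(3) eq(2) ay]
  have "adj y (x f) = 0" "adj x (y f) = 0" for f
    using sq[of "x f"] sq[of "y f"] by (simp_all add: x y)
  then show ?thesis
    using that[of x y] p xy x y by blast
qed

subsection \<open>The trace argument\<close>

text \<open>The powers of \<open>q = p 1_(-A) p\<close> in the corner of \<open>p\<close>; its unit
  is \<open>p\<close>, which explains the value at 0.\<close>

primrec corner_pow :: "'a op2 \<Rightarrow> 'a set \<Rightarrow> nat \<Rightarrow> 'a op2" where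
  "corner_pow p A 0 = p"
| "corner_pow p A (Suc n) = p o\<^sub>L ind (- A) o\<^sub>L p o\<^sub>L corner_pow p A n"

text \<open>Partial sums of the Neumann series of the inverse of \<open>p 1\<^sub>A p\<close> in the corner of \<open>p\<close>.\<close>

definition corner_inv :: "'a op2 \<Rightarrow> 'a set \<Rightarrow> nat \<Rightarrow> 'a op2" where
  "corner_inv p A n = (\<Sum>j<n. corner_pow p A j)"

lemma blinfun_sum_left: "blinfun_apply (\<Sum>j\<in>J. T j) f = (\<Sum>j\<in>J. blinfun_apply (T j) f)"
  by (induction J rule: infinite_finite_induct) (auto simp: blinfun.add_left)

lemma uniform_roe_algebra_sum:
  fixes T :: "'i \<Rightarrow> 'a::metric_space op2"
  assumes bg: "bounded_geometry TYPE('a)" and "\<And>j. j \<in> J \<Longrightarrow> T j \<in> uniform_roe_algebra"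
  shows "(\<Sum>j\<in>J. T j) \<in> uniform_roe_algebra"
proof -
  have "0 \<in> (uniform_roe_algebra :: 'a op2 set)"
    by (rule uniform_roe_algebra_has_prop[OF bg, of _ 0])
      (auto simp: clin_def has_prop_def intro!: ell2_eqI)
  then show ?thesis
    using assms(2)
    by (induction J rule: infinite_finite_induct) (auto intro: uniform_roe_algebra_add[OF bg])
qed

context
  fixes p :: "'a::metric_space op2" and A :: "'a set"
  assumes bg: "bounded_geometry TYPE('a)"
    and p: "p \<in> uniform_roe_algebra" "projection p"
    and small: "norm (p o\<^sub>L ind (- A)) \<le> 1 / 2"
begin

private lemma clin_p: "clin p"
  by (rule clin_uniform_roe_algebra[OF bg p(1)])

private lemma pp: "p (p f) = p f"
  by (rule projection_idem[OF p(2)])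

private lemma psa: "cinner (p f) g = cinner f (p g)"
  by (rule projection_cinner[OF clin_p p(2)])

private lemma norm_p: "norm p \<le> 1"
  by (rule norm_projection_le[OF clin_p p(2)])

lemma corner_pow_roe: "corner_pow p A n \<in> uniform_roe_algebra"
  by (induction n) (auto intro!: uniform_roe_algebra_compose[OF bg] uniform_roe_algebra_ind[OF bg] p)

lemma corner_inv_roe: "corner_inv p A n \<in> uniform_roe_algebra"
  unfolding corner_inv_def by (intro uniform_roe_algebra_sum[OF bg] corner_pow_roe)

lemma p_corner_pow: "p (corner_pow p A n f) = corner_pow p A n f"
  by (cases n) (simp_all add: pp)

lemma p_corner_inv: "p (corner_inv p A n f) = corner_inv p A n f"
  by (simp add: corner_inv_def blinfun_sum_left blinfun.sum_right p_corner_pow)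

lemma corner_pow_Suc_right: "corner_pow p A (Suc n) f = corner_pow p A n (p (ind (- A) (p f)))"
  by (induction n) (simp_all add: pp)

lemma norm_corner_pow: "norm (corner_pow p A n) \<le> (1 / 2) ^ n"
proof (induction n)
  case 0
  then show ?case by (simp add: norm_p)
next
  case (Suc n)
  have "norm (corner_pow p A (Suc n)) \<le> norm (p o\<^sub>L ind (- A)) * norm p * norm (corner_pow p A n)"
    by (simp, intro order_trans[OF norm_blinfun_compose] mult_right_mono norm_blinfun_compose) auto
  also have "\<dots> \<le> 1 / 2 * 1 * (1 / 2) ^ n"
    by (intro mult_mono small norm_p Suc.IH) auto
  finally show ?case by simp
qed

lemma norm_corner_inv: "norm (corner_inv p A n) \<le> 2"
proof -
  have "norm (corner_inv p A n) \<le> (\<Sum>j<n. (1 / 2) ^ j)"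
    unfolding corner_inv_def by (intro sum_norm_le norm_corner_pow)
  also have "\<dots> \<le> 2"
    by (simp add: sum_gp_strict)
  finally show ?thesis .
qed

text \<open>The telescoping \<open>(1 + q + ... + q^(n-1)) (1 - q) = 1 - q^n\<close> with unit
  \<open>p\<close>; the remainder \<open>q^n\<close> is carried along explicitly.\<close>

lemma corner_inv_ind_p: "corner_inv p A n (ind A (p f)) = p f - corner_pow p A n f"
proof -
  have "corner_pow p A j (ind A (p f)) = corner_pow p A j f - corner_pow p A (Suc j) f" for j
  proof -
    have right: "corner_pow p A j (p g) = corner_pow p A j g" for g
      by (induction j) (simp_all add: pp)
    have "ind A (p f) = p f - ind (- A) (p f)"
      by (rule ell2_eqI) simp
    then have "corner_pow p A j (ind A (p f)) = corner_pow p A j (p f) - corner_pow p A j (p (ind (- A) (p f)))"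
      by (simp only: blinfun.diff_right right)
    then show ?thesis
      by (simp only: right corner_pow_Suc_right)
  qed
  then have "corner_inv p A n (ind A (p f)) = (\<Sum>j<n. corner_pow p A j f - corner_pow p A (Suc j) f)"
    by (simp add: corner_inv_def blinfun_sum_left)
  also have "\<dots> = corner_pow p A 0 f - corner_pow p A n f"
    by (rule sum_lessThan_telescope')
  finally show ?thesis by simp
qed

text \<open>As \<open>q\<close> is self-adjoint, \<open>q^(m+2) = q q^m q\<close> lowers the
  exponent by two; the base cases \<open>p\<close> and \<open>q\<close> are squares of the form
  \<open>adj b b\<close>.\<close>

lemma corner_pow_positive: "0 \<le> Re (cinner f (corner_pow p A n f))"
proof (induction n arbitrary: f rule: nat_less_induct)
  case (1 n)
  consider "n = 0" | "n = 1" | m where "n = Suc (Suc m)"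
    by (metis One_nat_def not0_implies_Suc)
  then show ?case
  proof cases
    case 1
    then have "cinner f (corner_pow p A n f) = cinner (p f) (p f)"
      by (simp add: psa pp)
    then show ?thesis
      by (simp add: cinner_self del: of_real_power)
  next
    case 2
    have "ind (- A) (ind (- A) g) = ind (- A) g" for g
      by (rule ell2_eqI) simp
    then have "cinner f (corner_pow p A n f) = cinner (ind (- A) (p f)) (ind (- A) (p f))"
      using 2 cinner_adj_left[OF clin_ind, of "- A" "p f" "ind (- A) (p f)"] by (simp add: psa pp)
    then show ?thesis
      by (simp add: cinner_self del: of_real_power)
  next
    case 3
    let ?g = "p (ind (- A) (p f))"
    have "cinner f (corner_pow p A n f) = cinner ?g (corner_pow p A m ?g)"
      unfolding 3 corner_pow.simps(2)[of p A "Suc m"]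
      by (simp add: corner_pow_Suc_right psa cinner_adj_left[OF clin_ind, of "- A", simplified] del: corner_pow.simps)
    then show ?thesis
      using "1.IH" 3 by simp
  qed
qed

text \<open>The zeroth Neumann term contributes the left side and the others are positive;
  \<open>Suc n\<close> guarantees that the zeroth term is present.\<close>

lemma corner_inv_diagonal: "(norm (p (ket x)))\<^sup>2 \<le> Re (coord (corner_inv p A (Suc n) (ket x)) x)"
proof -
  have "coord (corner_inv p A (Suc n) (ket x)) x = cinner (ket x) (p (ket x)) +
      (\<Sum>j<n. cinner (ket x) (corner_pow p A (Suc j) (ket x)))"
    unfolding corner_inv_def sum.lessThan_Suc_shift by (simp add: blinfun.add_left blinfun_sum_left)
  moreover have "cinner (ket x) (p (ket x)) = cinner (p (ket x)) (p (ket x))"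
    by (simp only: psa pp)
  ultimately show ?thesis
    using sum_nonneg[of "{..<n}" "\<lambda>j. Re (cinner (ket x) (corner_pow p A (Suc j) (ket x)))"]
      corner_pow_positive by (simp add: cinner_self del: of_real_power cinner_ket_left corner_pow.simps)
qed

text \<open>With \<open>h\<close> the Neumann sum, \<open>\<tau>(u v h) \<approx> \<tau>((u h) 1\<^sub>A (v h))\<close>, which is symmetric in \<open>u\<close> and \<open>v\<close>
  because \<open>\<tau>\<close> is asymptotically tracial on the corner of \<open>1\<^sub>A\<close>.\<close>

lemma corner_trace_commute:
  fixes F :: "nat \<Rightarrow> 'a set"
  assumes F: "\<And>u v. u \<in> uniform_roe_algebra \<Longrightarrow> v \<in> uniform_roe_algebra \<Longrightarrow>
      (\<lambda>n. tr (F n) (u o\<^sub>L ind A o\<^sub>L v) - tr (F n) (v o\<^sub>L ind A o\<^sub>L u)) \<longlonglongrightarrow> 0"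
    and u: "u \<in> uniform_roe_algebra" "\<And>f. p (u f) = u f" "norm u \<le> 1"
    and v: "v \<in> uniform_roe_algebra" "\<And>f. p (v f) = v f" "norm v \<le> 1"
    and c: "4 * (1 / 2) ^ N < c"
  shows "\<forall>\<^sub>F n in sequentially.
    cmod (tr (F n) (u o\<^sub>L v o\<^sub>L corner_inv p A N) - tr (F n) (v o\<^sub>L u o\<^sub>L corner_inv p A N)) \<le> c"
proof -
  define h where "h = corner_inv p A N"
  define r where "r = corner_pow p A N"
  have split: "s o\<^sub>L t o\<^sub>L h = ((s o\<^sub>L h) o\<^sub>L ind A o\<^sub>L (t o\<^sub>L h)) + (s o\<^sub>L r o\<^sub>L t o\<^sub>L h)"
    if "\<And>f. p (t f) = t f" for s t :: "'a op2"
  proof (rule blinfun_eqI)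
    fix f
    have "h (ind A (t (h f))) = t (h f) - r (t (h f))"
      using corner_inv_ind_p[of N "t (h f)"] by (simp add: that h_def r_def)
    then show "(s o\<^sub>L t o\<^sub>L h) f = (((s o\<^sub>L h) o\<^sub>L ind A o\<^sub>L (t o\<^sub>L h)) + (s o\<^sub>L r o\<^sub>L t o\<^sub>L h)) f"
      by (simp add: blinfun.add_left blinfun.diff_right)
  qed
  \<comment> \<open>\<open>r\<close> contributes \<open>(1 / 2)^N\<close> and \<open>h\<close> the
    factor 2; two such remainders make up the \<open>4 * (1 / 2)^N\<close> that \<open>c\<close> has
    to exceed.\<close>
  have rest: "norm (s o\<^sub>L r o\<^sub>L t o\<^sub>L h) \<le> 2 * (1 / 2) ^ N" if "norm s \<le> 1" "norm t \<le> 1" for s t :: "'a op2"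
  proof -
    have "norm (s o\<^sub>L r o\<^sub>L t o\<^sub>L h) \<le> norm s * norm r * norm t * norm h"
      by (intro order_trans[OF norm_blinfun_compose] mult_right_mono order_refl) auto
    also have "\<dots> \<le> 1 * (1 / 2) ^ N * 1 * 2"
      unfolding h_def r_def by (intro mult_mono that norm_corner_pow norm_corner_inv mult_nonneg_nonneg) auto
    finally show ?thesis by simp
  qed
  have roe: "u o\<^sub>L h \<in> uniform_roe_algebra" "v o\<^sub>L h \<in> uniform_roe_algebra"
    unfolding h_def by (intro uniform_roe_algebra_compose[OF bg] u v corner_inv_roe)+
  have "\<forall>\<^sub>F n in sequentially. dist (tr (F n) ((u o\<^sub>L h) o\<^sub>L ind A o\<^sub>L (v o\<^sub>L h)) -
      tr (F n) ((v o\<^sub>L h) o\<^sub>L ind A o\<^sub>L (u o\<^sub>L h))) 0 < c - 4 * (1 / 2) ^ N"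
    using c by (intro tendstoD[OF F[OF roe]]) auto
  then show ?thesis
  proof eventually_elim
    case (elim n)
    have "tr (F n) (u o\<^sub>L v o\<^sub>L h) - tr (F n) (v o\<^sub>L u o\<^sub>L h) =
        (tr (F n) ((u o\<^sub>L h) o\<^sub>L ind A o\<^sub>L (v o\<^sub>L h)) - tr (F n) ((v o\<^sub>L h) o\<^sub>L ind A o\<^sub>L (u o\<^sub>L h))) +
        (tr (F n) (u o\<^sub>L r o\<^sub>L v o\<^sub>L h) - tr (F n) (v o\<^sub>L r o\<^sub>L u o\<^sub>L h))"
      unfolding split[OF u(2), of v] split[OF v(2), of u] tr_add by (simp add: algebra_simps)
    also have "cmod \<dots> \<le> (c - 4 * (1 / 2) ^ N) + (2 * (1 / 2) ^ N + 2 * (1 / 2) ^ N)"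
    proof (rule order_trans[OF norm_triangle_ineq], rule add_mono)
      show "cmod (tr (F n) (u o\<^sub>L r o\<^sub>L v o\<^sub>L h) - tr (F n) (v o\<^sub>L r o\<^sub>L u o\<^sub>L h))
          \<le> 2 * (1 / 2) ^ N + 2 * (1 / 2) ^ N"
        by (intro order_trans[OF norm_triangle_ineq4] add_mono order_trans[OF cmod_tr_le] rest u v)
    qed (use elim in simp)
    finally show ?case
      by (simp add: h_def)
  qed
qed

end

text \<open>Sums of the range projections of the isometries \<open>x, y x, y\<^sup>2 x, \<dots>\<close>, which are pairwise orthogonal.\<close>

primrec shift_proj :: "'a op2 \<Rightarrow> 'a op2 \<Rightarrow> nat \<Rightarrow> 'a op2" where
  "shift_proj x y 0 = 0"
| "shift_proj x y (Suc k) = (x o\<^sub>L adj x) + (y o\<^sub>L shift_proj x y k o\<^sub>L adj y)"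

lemma paradoxical_of_properly_infinite:
  fixes p :: "'a::metric_space op2"
  assumes bg: "bounded_geometry TYPE('a)" and pA: "property_A TYPE('a)"
    and pi: "properly_infinite_projection uniform_roe_algebra p" and "p \<noteq> 0"
  obtains A :: "'a set" where "A \<noteq> {}" "paradoxical A"
proof -
  obtain x y where p: "p \<in> uniform_roe_algebra" "projection p"
    and xy: "x \<in> uniform_roe_algebra" "y \<in> uniform_roe_algebra" "norm x \<le> 1" "norm y \<le> 1"
    and pxy: "\<And>f. p (x f) = x f" "\<And>f. p (y f) = y f"  "\<And>f. x (p f) = x f" "\<And>f. y (p f) = y f"
    and iso: "\<And>f. adj x (x f) = p f" "\<And>f. adj y (y f) = p f" "\<And>f. adj y (x f) = 0" "\<And>f. adj x (y f) = 0"
    by (rule properly_infiniteE[OF bg pi]) (rule that)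
  note clin = clin_uniform_roe_algebra[OF bg p(1)] clin_uniform_roe_algebra[OF bg xy(1)]
    clin_uniform_roe_algebra[OF bg xy(2)]
  have pp: "p (p f) = p f" for f
    by (rule projection_idem[OF p(2)])
  have psa: "cinner (p f) g = cinner f (p g)" for f g
    by (rule projection_cinner[OF clin(1) p(2)])
  have pax: "p (adj x f) = adj x f" for f
    by (rule ell2_cinner_eqI) (simp add: psa cinner_adj_left clin pxy)
  have pay: "p (adj y f) = adj y f" for f
    by (rule ell2_cinner_eqI) (simp add: psa cinner_adj_left clin pxy)
  obtain \<delta> where \<delta>: "0 < \<delta>" "norm (p o\<^sub>L ind {x. norm (p (ket x)) < \<delta>}) \<le> 1 / 2"
    using small_columns_negligible[OF bg pA p(1), of "1 / 2"] by auto
  define A where "A = {x. \<delta> \<le> norm (p (ket x))}"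
  have "- A = {x. norm (p (ket x)) < \<delta>}"
    by (auto simp: A_def)
  then have small: "norm (p o\<^sub>L ind (- A)) \<le> 1 / 2"
    using \<delta>(2) by simp
  have "A \<noteq> {}"
  proof
    assume "A = {}"
    then have "p o\<^sub>L ind (- A) = p"
      by (intro blinfun_eqI) simp
    then have p2: "norm p \<le> 1 / 2"
      using small by simp
    have "p f = 0" for f
    proof -
      have "norm (p f) \<le> norm p * norm (p f)"
        using norm_blinfun[of p "p f"] by (simp add: pp)
      also have "\<dots> \<le> 1 / 2 * norm (p f)"
        by (intro mult_right_mono p2) auto
      finally show ?thesis by simp
    qed
    then show False
      using \<open>p \<noteq> 0\<close> by (metis blinfun_eqI zero_blinfun.rep_eq)
  qed
  moreover have "paradoxical A"
  proof (rule ccontr)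
    assume np: "\<not> paradoxical A"
    obtain F :: "nat \<Rightarrow> 'a set" where F: "\<And>n. finite (F n)" "\<And>n. F n \<noteq> {}" "\<And>n. F n \<subseteq> A"
      and trace: "\<And>u v. u \<in> uniform_roe_algebra \<Longrightarrow> v \<in> uniform_roe_algebra \<Longrightarrow>
        (\<lambda>n. tr (F n) (u o\<^sub>L ind A o\<^sub>L v) - tr (F n) (v o\<^sub>L ind A o\<^sub>L u)) \<longlonglongrightarrow> 0"
      by (rule folner_sequence[OF bg \<open>A \<noteq> {}\<close> np]) (rule that)
    define Q where "Q = shift_proj x y"
    have Q_roe: "Q k \<in> uniform_roe_algebra" for k
    proof (induction k)
      case 0
      then show ?case
        using uniform_roe_algebra_sum[OF bg, of "{}"] by (simp add: Q_def)
    next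
      case (Suc k)
      then show ?case
        unfolding Q_def shift_proj.simps
        by (intro uniform_roe_algebra_add[OF bg] uniform_roe_algebra_compose[OF bg]
            uniform_roe_algebra_adj[OF bg] xy)
    qed
    have clin_Q: "clin (Q k)" for k
      by (rule clin_uniform_roe_algebra[OF bg Q_roe])
    have pQ: "p (Q k f) = Q k f" for k f
      by (cases k) (simp_all add: Q_def blinfun.add_left blinfun.add_right pxy)
    \<comment> \<open>Mixed terms vanish because the ranges of \<open>x\<close> and \<open>y\<close>
      are orthogonal, and the \<open>p\<close> arising from \<open>adj y (y f)\<close> is absorbed
      by \<open>Q k\<close>.\<close>
    have QQ: "Q k (Q k f) = Q k f" for k f
      unfolding Q_def
      by (induction k arbitrary: f)
        (simp_all add: blinfun.add_left blinfun.add_right iso pax pay pQ[unfolded Q_def])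
    have Qsa: "cinner (Q k f) g = cinner f (Q k g)" for k f g
    proof (induction k arbitrary: f g)
      case (Suc k)
      have "cinner (x (adj x f)) g = cinner f (x (adj x g))"
        using cinner_adj_right[OF clin(2)] cinner_adj_left[OF clin(2)] by metis
      moreover have "cinner (y (Q k (adj y f))) g = cinner f (y (Q k (adj y g)))"
        using cinner_adj_right[OF clin(3)] cinner_adj_left[OF clin(3)] Suc.IH by metis
      ultimately show ?case
        by (simp add: Q_def blinfun.add_left cinner_add_left cinner_add_right)
    qed (simp add: Q_def)
    have norm_Q: "norm (Q k) \<le> 1" for k
    proof (rule norm_projection_le[OF clin_Q])
      show "projection (Q k)"
        unfolding projection_def using QQ Qsa by (auto intro!: blinfun_eqI adj_unique)
    qed
    \<comment> \<open>The count below accumulates the error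
      \<open>2 * k * c = k * \<delta>^2 / 2\<close>, half of the lower bound
      \<open>k * \<delta>^2\<close> for \<open>k\<close> times the trace of
      \<open>h\<close>.\<close>
    define c where "c = \<delta>\<^sup>2 / 4"
    have "0 < c / 4"
      using \<delta>(1) by (simp add: c_def)
    then obtain M where "(1 / 2 :: real) ^ M < c / 4"
      using real_arch_pow_inv[of "c / 4" "1 / 2"] by auto
    moreover have "(1 / 2 :: real) ^ Suc M \<le> (1 / 2) ^ M"
      by simp
    ultimately have cM: "4 * (1 / 2) ^ Suc M < c"
      by linarith
    \<comment> \<open>\<open>corner_inv_diagonal\<close> requires at least one term, hence
      \<open>Suc M\<close>. Both \<open>c\<close> and \<open>h\<close> are fixed before
      \<open>k\<close> is chosen.\<close>
    define h where "h = corner_inv p A (Suc M)"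
    have ph: "p (h f) = h f" for f
      unfolding h_def by (rule p_corner_inv[OF bg p small])
    note commute = corner_trace_commute[OF bg p small trace _ _ _ _ _ _ cM, folded h_def]
    have adj_le: "norm (adj x) \<le> 1" "norm (adj y) \<le> 1"
      using norm_adj_le[OF clin(2)] norm_adj_le[OF clin(3)] xy by linarith+
    have yQ: "norm (y o\<^sub>L Q k) \<le> 1" for k
      using norm_blinfun_compose[of y "Q k"] mult_mono[OF xy(4) norm_Q[of k]] by simp
    \<comment> \<open>Each new subprojection costs two commutations, one for \<open>x\<close> with
      \<open>adj x\<close> and one for \<open>y o\<^sub>L Q k\<close> with \<open>adj y\<close>,
      hence \<open>2 * c\<close> per step. The factor \<open>p\<close> left over is absorbed by
      \<open>h\<close> and by \<open>Q k\<close>.\<close>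
    have count: "\<forall>\<^sub>F n in sequentially. cmod (tr (F n) (Q k o\<^sub>L h) - k * tr (F n) h) \<le> 2 * real k * c" for k
    proof (induction k)
      case 0
      then show ?case
        by (simp add: Q_def tr_def)
    next
      case (Suc k)
      have 1: "\<forall>\<^sub>F n in sequentially. cmod (tr (F n) (x o\<^sub>L adj x o\<^sub>L h) - tr (F n) (adj x o\<^sub>L x o\<^sub>L h)) \<le> c"
        by (intro commute uniform_roe_algebra_adj[OF bg] xy adj_le) (simp_all add: pxy pax)
      have 2: "\<forall>\<^sub>F n in sequentially. cmod (tr (F n) ((y o\<^sub>L Q k) o\<^sub>L adj y o\<^sub>L h) -
          tr (F n) (adj y o\<^sub>L (y o\<^sub>L Q k) o\<^sub>L h)) \<le> c"
        by (intro commute uniform_roe_algebra_adj[OF bg] uniform_roe_algebra_compose[OF bg] Q_roe xy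
            adj_le yQ) (simp_all add: pxy pay)
      have xh: "adj x o\<^sub>L x o\<^sub>L h = h"
        by (rule blinfun_eqI) (simp add: iso ph)
      have yh: "adj y o\<^sub>L (y o\<^sub>L Q k) o\<^sub>L h = Q k o\<^sub>L h"
        by (rule blinfun_eqI) (simp add: iso pQ)
      have Qh: "Q (Suc k) o\<^sub>L h = (x o\<^sub>L adj x o\<^sub>L h) + ((y o\<^sub>L Q k) o\<^sub>L adj y o\<^sub>L h)"
        by (rule blinfun_eqI) (simp add: Q_def blinfun.add_left)
      from 1 2 Suc.IH show ?case
      proof eventually_elim
        case (elim n)
        have "tr (F n) (Q (Suc k) o\<^sub>L h) - Suc k * tr (F n) h =
            (tr (F n) (x o\<^sub>L adj x o\<^sub>L h) - tr (F n) h) +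
            (tr (F n) ((y o\<^sub>L Q k) o\<^sub>L adj y o\<^sub>L h) - tr (F n) (Q k o\<^sub>L h)) +
            (tr (F n) (Q k o\<^sub>L h) - k * tr (F n) h)"
          unfolding Qh tr_add by (simp add: algebra_simps)
        also have "cmod \<dots> \<le> c + c + 2 * real k * c"
          using elim unfolding xh yh by (intro order_trans[OF norm_triangle_ineq] add_mono)
        finally show ?case
          by (simp add: algebra_simps)
      qed
    qed
    have lower: "\<delta>\<^sup>2 \<le> Re (tr (F n) h)" for n
    proof -
      have "\<delta>\<^sup>2 \<le> Re (coord (h (ket z)) z)" if "z \<in> F n" for z
      proof -
        have "\<delta>\<^sup>2 \<le> (norm (p (ket z)))\<^sup>2"
          using that F(3) \<delta>(1) by (intro power_mono) (auto simp: A_def)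
        also have "\<dots> \<le> Re (coord (h (ket z)) z)"
          unfolding h_def by (rule corner_inv_diagonal[OF bg p small])
        finally show ?thesis .
      qed
      then have "real (card (F n)) * \<delta>\<^sup>2 \<le> (\<Sum>z\<in>F n. Re (coord (h (ket z)) z))"
        using sum_mono[of "F n" "\<lambda>_. \<delta>\<^sup>2"] by simp
      moreover have "0 < card (F n)"
        using F by (simp add: card_gt_0_iff)
      moreover have "Re (tr (F n) h) = (\<Sum>z\<in>F n. Re (coord (h (ket z)) z)) / card (F n)"
        unfolding tr_def by (metis Re_divide_of_nat Re_sum)
      ultimately show ?thesis
        by (simp add: pos_le_divide_eq mult.commute)
    qed
    \<comment> \<open>For this \<open>k\<close> the inequality
      \<open>k * \<delta>^2 \<le> 2 + k * \<delta>^2 / 2\<close> fails; its 2 bounds the norm of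
      \<open>Q k o\<^sub>L h\<close> for every \<open>k\<close>.\<close>
    obtain k :: nat where k: "4 / \<delta>\<^sup>2 < k"
      using reals_Archimedean2 by blast
    obtain n where n: "cmod (tr (F n) (Q k o\<^sub>L h) - k * tr (F n) h) \<le> 2 * real k * c"
      using count[of k] by (auto simp: eventually_sequentially)
    have "norm (Q k o\<^sub>L h) \<le> 1 * 2"
      unfolding h_def
      by (intro order_trans[OF norm_blinfun_compose] mult_mono norm_Q norm_corner_inv[OF bg p small]) auto
    then have "cmod (tr (F n) (Q k o\<^sub>L h)) \<le> 2"
      using cmod_tr_le[of "F n" "Q k o\<^sub>L h"] by linarith
    have "k * \<delta>\<^sup>2 \<le> k * Re (tr (F n) h)"
      by (intro mult_left_mono lower) auto
    also have "\<dots> = Re (k * tr (F n) h)"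
      by simp
    also have "\<dots> \<le> cmod (k * tr (F n) h)"
      by (rule complex_Re_le_cmod)
    also have "\<dots> \<le> cmod (tr (F n) (Q k o\<^sub>L h)) + cmod (tr (F n) (Q k o\<^sub>L h) - k * tr (F n) h)"
      using norm_triangle_sub[of "k * tr (F n) h" "tr (F n) (Q k o\<^sub>L h)"] by (simp add: norm_minus_commute)
    also have "\<dots> \<le> 2 + 2 * real k * c"
      using n \<open>cmod (tr (F n) (Q k o\<^sub>L h)) \<le> 2\<close> by linarith
    also have "\<dots> = 2 + k * \<delta>\<^sup>2 / 2"
      by (simp add: c_def)
    finally have "k * \<delta>\<^sup>2 \<le> 4"
      by simp
    then show False
      using k \<delta>(1) by (simp add: field_simps)
  qed
  ultimately show ?thesis
    by (rule that)
qed

theorem proposition4p6: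
  assumes "bounded_geometry TYPE('a::metric_space)"
    and "property_A TYPE('a)"
  shows "supramenable TYPE('a) \<longleftrightarrow>
    \<not> (\<exists>p :: 'a op2. p \<noteq> 0 \<and> properly_infinite_projection uniform_roe_algebra p)"
proof
  assume "supramenable TYPE('a)"
  then show "\<not> (\<exists>p :: 'a op2. p \<noteq> 0 \<and> properly_infinite_projection uniform_roe_algebra p)"
    unfolding supramenable_def using paradoxical_of_properly_infinite[OF assms] by metis
next
  assume none: "\<not> (\<exists>p :: 'a op2. p \<noteq> 0 \<and> properly_infinite_projection uniform_roe_algebra p)"
  have "\<not> paradoxical A" if "A \<noteq> {}" for A :: "'a set"
  proof
    assume "paradoxical A"
    then have "ind A = 0"
      using none properly_infinite_ind[OF assms(1)] by blast
    moreover obtain a where "a \<in> A"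
      using \<open>A \<noteq> {}\<close> by blast
    ultimately show False
      using coord_ind[of A "ket a" a] by simp
  qed
  then show "supramenable TYPE('a)"
    by (simp add: supramenable_def)
qed

end
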